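(* Let $G$ be an infinite, connected, vertex-transitive, simple cubic graph of girth $3$. Then $$x_1\le\mu(G)\le x_2,$$ where $x_1,x_2\in(1,2)$ satisfy $$\frac1{x_1^2}+\frac1{x_1^3}=\frac1{\sqrt2},\qquad \frac1{x_2^2}+\frac1{x_2^3}=\frac12.$$ Moreover, the upper bound $x_2$ is sharp, i.e. there exists such a graph $G$ with $\mu(G)=x_2$.
   Context: Cubic means that every vertex has degree 3; girth is the length of a shortest cycle. A self-avoiding walk (SAW) is a walk with no repeated vertex; $\sigma_n(v)$ is the number of $n$-step SAWs from $v$, and the connective constant is $\mu(G)=\lim_{n\to\infty}\sigma_n(v)^{1/n}$ (the limit exists and is independent of $v$). *)

theory Defs
  imports "HOL-Analysis.Analysis" "Graph_Theory.Graph_Theory"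
begin

text \<open>
  Simple graphs, finite or infinite, are the loop-free symmetric digraphs without parallel
  arcs: an undirected edge \<open>{u, v}\<close> is the pair of arcs \<open>(u, v)\<close>, \<open>(v, u)\<close>.
\<close>
abbreviation simple_graph :: "'a pair_pre_digraph \<Rightarrow> bool" where
  "simple_graph \<equiv> pair_bidirected_digraph"

text \<open>
  The degree of \<open>v\<close> is the number of arcs leaving \<open>v\<close>. An infinite set has cardinality 0,
  so a vertex of infinite degree does not count as having degree 3.
\<close>
definition cubic :: "'a pair_pre_digraph \<Rightarrow> bool" where
  "cubic G \<longleftrightarrow> (\<forall>v\<in>pverts G. out_degree (with_proj G) v = 3)"

definition automorphism :: "'a pair_pre_digraph \<Rightarrow> ('a \<Rightarrow> 'a) \<Rightarrow> bool" where
  "automorphism G f \<longleftrightarrow> bij_betw f (pverts G) (pverts G) \<and>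
     (\<forall>u\<in>pverts G. \<forall>v\<in>pverts G. (f u, f v) \<in> parcs G \<longleftrightarrow> (u, v) \<in> parcs G)"

definition vertex_transitive :: "'a pair_pre_digraph \<Rightarrow> bool" where
  "vertex_transitive G \<longleftrightarrow>
     (\<forall>u\<in>pverts G. \<forall>v\<in>pverts G. \<exists>f. automorphism G f \<and> f u = v)"

text \<open>
  The library's cycles are directed, so traversing an edge back and forth is one, of length 2.
  Requiring length at least 3 leaves the cycles of the undirected graph.
  The girth of a graph without cycles is \<open>\<infinity>\<close>.
\<close>
definition girth :: "'a pair_pre_digraph \<Rightarrow> enat" where
  "girth G = (INF p\<in>{p. pre_digraph.cycle (with_proj G) p \<and> 3 \<le> length p}. enat (length p))"

text \<open>The library's \<open>vpath\<close> is a walk, given by its list of vertices, that repeats no vertex.\<close>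
definition saw_count :: "'a pair_pre_digraph \<Rightarrow> nat \<Rightarrow> 'a \<Rightarrow> nat" where
  "saw_count G n v = card {p. vpath p (with_proj G) \<and> hd p = v \<and> vwalk_length p = n}"

text \<open>
  The common limit over all base vertices; only meaningful when these limits exist and
  agree, otherwise the value is unspecified.
\<close>
definition connective_constant :: "'a pair_pre_digraph \<Rightarrow> real" where
  "connective_constant G =
     (THE \<mu>. \<forall>v\<in>pverts G. (\<lambda>n. root n (real (saw_count G n v))) \<longlonglongrightarrow> \<mu>)"

text \<open>\<open>connected\<close> alone could also denote topological connectedness, hence the qualifier.\<close>
definition infinite_transitive_cubic_graph :: "'a pair_pre_digraph \<Rightarrow> bool" where
  "infinite_transitive_cubic_graph G \<longleftrightarrow>
     simple_graph G \<and> infinite (pverts G) \<and> Digraph_Component.connected (with_proj G) \<and>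
     vertex_transitive G \<and> cubic G"

text \<open>
  Both defining equations, with right-hand sides \<open>1 / sqrt 2\<close> and \<open>1 / 2\<close>, have
  exactly one solution in the open interval from 1 to 2.
\<close>
lemma ex1_bound_equation:
  fixes c :: real
  assumes "3 / 8 < c" "c < 2"
  shows "\<exists>!x. 1 < x \<and> x < 2 \<and> 1 / x^2 + 1 / x^3 = c"
proof -
  let ?f = "\<lambda>x::real. 1 / x^2 + 1 / x^3"
  have "\<exists>x\<ge>1. x \<le> 2 \<and> ?f x = c"
    using assms by (intro IVT2') (auto intro!: continuous_intros simp: field_simps)
  then obtain x where x: "1 \<le> x" "x \<le> 2" "?f x = c" by blast
  have "x \<noteq> 1" "x \<noteq> 2" using x(3) assms by auto
  have decr: "?f b < ?f a" if "1 < a" "a < b" for a b :: real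
  proof -
    have "a ^ 2 < b ^ 2" "a ^ 3 < b ^ 3" using that by (auto intro!: power_strict_mono)
    then have "1 / b ^ 2 < 1 / a ^ 2" "1 / b ^ 3 < 1 / a ^ 3"
      using that by (auto intro!: divide_strict_left_mono mult_pos_pos)
    then show ?thesis by linarith
  qed
  show ?thesis
  proof (rule ex1I[of _ x])
    show "1 < x \<and> x < 2 \<and> ?f x = c" using x \<open>x \<noteq> 1\<close> \<open>x \<noteq> 2\<close> by auto
  next
    fix y assume "1 < y \<and> y < 2 \<and> ?f y = c"
    then show "y = x"
      using decr[of x y] decr[of y x] x \<open>x \<noteq> 1\<close> by (cases x y rule: linorder_cases) auto
  qed
qed

lemma ex1_bound_equation_sqrt: "\<exists>!x::real. 1 < x \<and> x < 2 \<and> 1 / x^2 + 1 / x^3 = 1 / sqrt 2"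
proof (rule ex1_bound_equation)
  have "1 < sqrt 2" "sqrt 2 \<le> 2" by (auto intro: real_le_lsqrt)
  then have "1 < 2 * sqrt 2" "3 * sqrt 2 < 8" by linarith+
  then show "3 / 8 < 1 / sqrt 2" "1 / sqrt 2 < 2" by (auto simp: field_simps)
qed

lemma ex1_bound_equation_half: "\<exists>!x::real. 1 < x \<and> x < 2 \<and> 1 / x^2 + 1 / x^3 = 1 / 2"
  by (rule ex1_bound_equation) auto

end

theory Submission
  imports Defs
begin

text \<open>
  Each vertex of such a graph lies in exactly one triangle, and a self-avoiding walk alternates
  between outer edges and passages through triangles. Having entered a triangle through an outer
  edge, the walk leaves it through one of two exits, reached after one or two more steps. Hence
  the number \<open>s\<^sub>n\<close> of walks after such an entry satisfies \<open>s\<^sub>n \<le> 2 s\<^sub>n\<^sub>-\<^sub>2 + 2 s\<^sub>n\<^sub>-\<^sub>3\<close>, which gives the upper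
  bound; equality holds when the triangles form a tree.

  For the lower bound, use only exits from which the walk can still escape to infinity after
  removal of the set \<open>S\<close> of all visited triangles. Let the potential of \<open>S\<close> be the number of arcs
  from \<open>S\<close> into the infinite components of the complement. By transitivity no finite vertex set
  has exactly one boundary edge, and this makes the potential fall by at least 1 whenever only one
  exit is available; it grows by at most 1 when there are two. So about half of the passages leave
  a choice of two exits, and the sum of \<open>r\<close> to the length over all walks diverges as soon as
  \<open>r\<^sup>2 + r\<^sup>3 = 1 / sqrt 2\<close>.
\<close>

section \<open>Counting self-avoiding walks\<close>

text \<open>Fekete's argument: \<open>ln (a n) / n\<close> tends to its infimum, because writing
  \<open>n = q * m + r\<close> bounds it by the value at \<open>m\<close> plus an error of order
  \<open>1 / n\<close>.\<close>

lemma submultiplicative_root_convergent: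
  fixes a :: "nat \<Rightarrow> real"
  assumes ge1: "\<And>n. 1 \<le> a n" and submult: "\<And>m n. a (m + n) \<le> a m * a n"
  shows "convergent (\<lambda>n. root n (a n))"
proof -
  define b where "b n = ln (a n) / n" for n
  define L where "L = (INF n\<in>{1..}. b n)"
  have pos: "0 < a n" for n using ge1[of n] by linarith
  have b_nonneg: "0 \<le> b n" for n using ge1 by (simp add: b_def)
  then have bdd: "bdd_below (b ` {1..})" by (intro bdd_belowI2[where m = 0]) auto
  have L_le: "L \<le> b n" if "n \<ge> 1" for n
    unfolding L_def using that by (intro cINF_lower bdd) auto
  have "b \<longlonglongrightarrow> L"
  proof (rule LIMSEQ_I)
    fix e :: real assume "0 < e"
    obtain m where m: "m \<ge> 1" "b m < L + e / 2"
    proof -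
      have "\<exists>m\<in>{1..}. b m < L + e / 2"
        using cINF_less_iff[of "{1..}" b "L + e / 2"] bdd \<open>0 < e\<close> unfolding L_def by auto
      then show ?thesis using that by auto
    qed
    \<comment> \<open>All logarithms are nonnegative, so their sum bounds the contribution of every
      possible remainder at once.\<close>
    define C where "C = (\<Sum>r<m. ln (a r))"
    have C: "ln (a r) \<le> C" if "r < m" for r
      unfolding C_def using that ge1 by (intro member_le_sum) auto
    have power: "a (q * m + r) \<le> a m ^ q * a r" for q r
    proof (induction q)
      case (Suc q)
      have "a (Suc q * m + r) = a (m + (q * m + r))" by (simp add: algebra_simps)
      also have "\<dots> \<le> a m * (a m ^ q * a r)"
        using submult[of m "q * m + r"] mult_left_mono[OF Suc, of "a m"] pos[of m] by linarith
      finally show ?case by (simp add: algebra_simps)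
    qed simp
    have bound: "b n \<le> b m + C / n" if "n \<ge> 1" for n
    proof -
      define q r where "q = n div m" and "r = n mod m"
      have n: "n = q * m + r" and r: "r < m" using m(1) by (auto simp: q_def r_def)
      have "ln (a n) \<le> ln (a m ^ q * a r)"
        using power[of q r] pos by (subst ln_le_cancel_iff) (auto simp: n)
      also have "\<dots> = q * ln (a m) + ln (a r)"
        using pos by (subst ln_mult_pos) (auto simp: ln_realpow)
      also have "\<dots> \<le> q * (m * b m) + C" using C[OF r] m(1) by (auto simp: b_def)
      also have "q * (m * b m) \<le> n * b m"
      proof -
        have "q * m \<le> n" by (simp add: q_def)
        then have "real (q * m) * b m \<le> n * b m" by (intro mult_right_mono b_nonneg of_nat_mono)
        then show ?thesis by (simp add: algebra_simps)
      qed
      finally show ?thesis using that by (simp add: b_def field_simps)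
    qed
    obtain n0 :: nat where n0: "n0 > 2 * \<bar>C\<bar> / e" using reals_Archimedean2 by blast
    show "\<exists>no. \<forall>n\<ge>no. norm (b n - L) < e"
    proof (intro exI allI impI)
      fix n assume n: "n \<ge> max n0 1"
      have "real n > 2 * \<bar>C\<bar> / e" using n n0 by linarith
      then have "C / n < e / 2" using n \<open>0 < e\<close> by (auto simp: field_simps)
      moreover have "1 \<le> n" using n by simp
      ultimately show "norm (b n - L) < e"
        using bound[of n] L_le[of n] m(2) unfolding real_norm_def by linarith
    qed
  qed
  then have "(\<lambda>n. exp (b n)) \<longlonglongrightarrow> exp L" by (intro tendsto_exp)
  moreover have "eventually (\<lambda>n. exp (b n) = root n (a n)) sequentially"
    using eventually_gt_at_top[of 0]
  proof eventually_elim
    case (elim n)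
    have "root n (a n) = exp (ln (root n (a n)))" using pos elim by simp
    then show ?case using elim pos by (simp add: b_def ln_root)
  qed
  ultimately have "(\<lambda>n. root n (a n)) \<longlonglongrightarrow> exp L" by (rule Lim_transform_eventually)
  then show ?thesis by (auto simp: convergent_def)
qed

text \<open>
  Counts the \<open>n\<close>-step self-avoiding walks from \<open>v\<close> whose vertices other than \<open>v\<close> lie outside \<open>X\<close>.
\<close>
fun saws :: "('a \<Rightarrow> 'a set) \<Rightarrow> 'a set \<Rightarrow> 'a \<Rightarrow> nat \<Rightarrow> nat" where
  "saws N X v 0 = 1"
| "saws N X v (Suc n) = (\<Sum>w\<in>N v - insert v X. saws N (insert v X) w n)"

definition neighbours :: "'a pair_pre_digraph \<Rightarrow> 'a \<Rightarrow> 'a set" where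
  "neighbours G v = {w. (v, w) \<in> parcs G}"

text \<open>Induction by removing the first vertex, which then joins the forbidden set. Only the
  tail has to avoid \<open>X\<close>. Finiteness is carried along because the cardinality of a
  disjoint union requires it.\<close>

lemma card_vpaths_eq_saws:
  assumes "pair_wf_digraph G" and fin: "\<And>v. v \<in> pverts G \<Longrightarrow> finite (neighbours G v)"
    and "v \<in> pverts G"
  shows "finite {p. vpath p (with_proj G) \<and> hd p = v \<and> length p = Suc n \<and> set (tl p) \<inter> X = {}} \<and>
    card {p. vpath p (with_proj G) \<and> hd p = v \<and> length p = Suc n \<and> set (tl p) \<inter> X = {}} =
    saws (neighbours G) X v n"
  using assms(3)
proof (induction n arbitrary: X v)
  case 0
  have "{p. vpath p (with_proj G) \<and> hd p = v \<and> length p = Suc 0 \<and> set (tl p) \<inter> X = {}} = {[v]}"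
    using 0 by (auto simp: length_Suc_conv vpath_def vwalk_def)
  then show ?case by simp
next
  case (Suc n)
  interpret pair_wf_digraph G by fact
  define P where "P X v n =
    {p. vpath p (with_proj G) \<and> hd p = v \<and> length p = Suc n \<and> set (tl p) \<inter> X = {}}" for X v n
  define W where "W = neighbours G v - insert v X"
  have W: "w \<in> pverts G" if "w \<in> W" for w
    using that by (auto simp: W_def neighbours_def dest: in_arcsD2)
  have eq: "P X v (Suc n) = (\<Union>w\<in>W. (#) v ` P (insert v X) w n)"
  proof (intro equalityI subsetI)
    fix p assume p: "p \<in> P X v (Suc n)"
    then obtain w q where q: "p = v # w # q"
      by (auto simp: P_def length_Suc_conv)
    have "w \<in> W" "w # q \<in> P (insert v X) w n"
      using p unfolding q P_def W_def neighbours_def by (auto simp: vpath_def vwalk_def)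
    then show "p \<in> (\<Union>w\<in>W. (#) v ` P (insert v X) w n)" unfolding q by blast
  next
    fix p assume "p \<in> (\<Union>w\<in>W. (#) v ` P (insert v X) w n)"
    then obtain w p' where "w \<in> W" "p' \<in> P (insert v X) w n" and p: "p = v # p'" by blast
    moreover from this obtain q where "p' = w # q" by (cases p') (auto simp: P_def)
    ultimately show "p \<in> P X v (Suc n)"
      using Suc.prems by (auto simp: P_def W_def neighbours_def vpath_def vwalk_def)
  qed
  have finW: "finite W" using fin[OF Suc.prems] by (simp add: W_def)
  have IH: "finite (P Y w n) \<and> card (P Y w n) = saws (neighbours G) Y w n" if "w \<in> W" for w Y
    using Suc.IH[OF W[OF that]] by (simp add: P_def)
  have "card (P X v (Suc n)) = (\<Sum>w\<in>W. card ((#) v ` P (insert v X) w n))"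
    unfolding eq
  proof (rule card_UN_disjoint)
    show "\<forall>w\<in>W. finite ((#) v ` P (insert v X) w n)" using IH by blast
    show "\<forall>w\<in>W. \<forall>w'\<in>W. w \<noteq> w' \<longrightarrow>
        (#) v ` P (insert v X) w n \<inter> (#) v ` P (insert v X) w' n = {}"
      by (auto simp: P_def)
  qed (rule finW)
  also have "\<dots> = (\<Sum>w\<in>W. saws (neighbours G) (insert v X) w n)"
    using IH by (intro sum.cong) (auto simp: card_image inj_on_def)
  finally have "card (P X v (Suc n)) = saws (neighbours G) X v (Suc n)" by (simp add: W_def)
  moreover have "finite (P X v (Suc n))" unfolding eq using finW IH by blast
  ultimately show ?case unfolding P_def by blast
qed

lemma saw_count_eq_saws:
  assumes "pair_wf_digraph G" "\<And>v. v \<in> pverts G \<Longrightarrow> finite (neighbours G v)" "v \<in> pverts G"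
  shows "saw_count G n v = saws (neighbours G) {} v n"
proof -
  have "{p. vpath p (with_proj G) \<and> hd p = v \<and> vwalk_length p = n} =
    {p. vpath p (with_proj G) \<and> hd p = v \<and> length p = Suc n \<and> set (tl p) \<inter> {} = {}}"
    by (auto simp: vpath_def vwalk_def neq_Nil_conv)
  then show ?thesis
    using card_vpaths_eq_saws[OF assms, of n "{}"] by (simp add: saw_count_def)
qed

text \<open>The graph reduced to its neighbourhood function. Connectedness takes the form
  \<open>closed_eq\<close>: a nonempty vertex set closed under neighbours is everything.\<close>

locale transitive_cubic =
  fixes V :: "'a set" and N :: "'a \<Rightarrow> 'a set"
  assumes nbs_in: "v \<in> V \<Longrightarrow> N v \<subseteq> V"
    and nbs_sym: "v \<in> V \<Longrightarrow> w \<in> N v \<Longrightarrow> v \<in> N w"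
    and nbs_irrefl: "v \<notin> N v"
    and card_nbs: "v \<in> V \<Longrightarrow> card (N v) = 3"
    and inf: "infinite V"
    and closed_eq: "W \<subseteq> V \<Longrightarrow> W \<noteq> {} \<Longrightarrow> (\<And>v. v \<in> W \<Longrightarrow> N v \<subseteq> W) \<Longrightarrow> W = V"
    and transitive: "u \<in> V \<Longrightarrow> v \<in> V \<Longrightarrow>
      \<exists>f. bij_betw f V V \<and> (\<forall>x\<in>V. N (f x) = f ` N x) \<and> f u = v"

lemma transitive_cubic_neighbours:
  assumes "infinite_transitive_cubic_graph G"
  shows "transitive_cubic (pverts G) (neighbours G)"
proof -
  have G: "pair_bidirected_digraph G" "infinite (pverts G)" "vertex_transitive G" "cubic G"
    and conn: "Digraph_Component.connected (with_proj G)"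
    using assms by (auto simp: infinite_transitive_cubic_graph_def)
  interpret pair_bidirected_digraph G by fact
  have sym: "(v, w) \<in> parcs G \<longleftrightarrow> (w, v) \<in> parcs G" for v w
    using pair_sym_arcs by (auto simp: symmetric_def sym_def)
  show ?thesis
  proof
    show "neighbours G v \<subseteq> pverts G" if "v \<in> pverts G" for v
      by (auto simp: neighbours_def dest: in_arcsD2)
    show "v \<in> neighbours G w" if "w \<in> neighbours G v" for v w
      using that sym by (auto simp: neighbours_def)
    show "v \<notin> neighbours G v" for v using pair_no_loops by (force simp: neighbours_def)
    show "card (neighbours G v) = 3" if "v \<in> pverts G" for v
    proof -
      have "out_arcs (with_proj G) v = Pair v ` neighbours G v"
        by (auto simp: neighbours_def out_arcs_def)
      then show ?thesis using G(4) that
        by (auto simp: cubic_def out_degree_def card_image inj_on_def)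
    qed
    show "infinite (pverts G)" by fact
    show "W = pverts G" if W: "W \<subseteq> pverts G" "W \<noteq> {}" "\<And>v. v \<in> W \<Longrightarrow> neighbours G v \<subseteq> W" for W
    proof -
      obtain u where u: "u \<in> W" using W by blast
      \<comment> \<open>Symmetry of the arcs turns connectedness into directed reachability, along
        which membership in \<open>W\<close> propagates.\<close>
      have "strongly_connected (with_proj G)"
        using symmetric_connected_imp_strongly_connected[OF pair_sym_arcs conn] .
      then have reach: "u \<rightarrow>\<^sup>*\<^bsub>with_proj G\<^esub> v" if "v \<in> pverts G" for v
        using that u W(1) by (auto simp: strongly_connected_def)
      have "v \<in> W" if "u \<rightarrow>\<^sup>*\<^bsub>with_proj G\<^esub> v" for v
        using that unfolding reachable_def
      proof (induction rule: rtrancl_on_induct)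
        case (step x y)
        then show ?case using W(3)[of x] by (auto simp: neighbours_def)
      qed (use u in auto)
      then show ?thesis using reach W(1) by blast
    qed
    show "\<exists>f. bij_betw f (pverts G) (pverts G) \<and>
        (\<forall>x\<in>pverts G. neighbours G (f x) = f ` neighbours G x) \<and> f u = v"
      if uv: "u \<in> pverts G" "v \<in> pverts G" for u v
    proof -
      obtain f where f: "automorphism G f" "f u = v"
        using G(3) uv unfolding vertex_transitive_def by blast
      have bij: "bij_betw f (pverts G) (pverts G)"
        and arc: "\<And>x y. x \<in> pverts G \<Longrightarrow> y \<in> pverts G \<Longrightarrow> (f x, f y) \<in> parcs G \<longleftrightarrow> (x, y) \<in> parcs G"
        using f(1) by (auto simp: automorphism_def)
      have "neighbours G (f x) = f ` neighbours G x" if x: "x \<in> pverts G" for x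
      proof (intro equalityI subsetI)
        fix z assume "z \<in> neighbours G (f x)"
        then have z: "(f x, z) \<in> parcs G" by (simp add: neighbours_def)
        then have "z \<in> f ` pverts G" using in_arcsD2 bij by (auto simp: bij_betw_def)
        then obtain y where "y \<in> pverts G" "z = f y" by blast
        then show "z \<in> f ` neighbours G x" using z arc x by (auto simp: neighbours_def)
      qed (use x arc in \<open>auto simp: neighbours_def dest: in_arcsD2\<close>)
      then show ?thesis using bij f(2) by blast
    qed
  qed
qed

text \<open>Automorphisms carry walks to walks, provided that the forbidden set is moved along.
  Injectivity on \<open>V\<close> keeps visited and unvisited vertices apart.\<close>

lemma saws_image:
  assumes "inj_on f V" "X \<subseteq> V" "v \<in> V" and nbs: "\<And>x. x \<in> V \<Longrightarrow> N x \<subseteq> V \<and> N (f x) = f ` N x"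
  shows "saws N (f ` X) (f v) n = saws N X v n"
  using assms(2,3)
proof (induction n arbitrary: X v)
  case (Suc n)
  have sub: "insert v X \<subseteq> V" "N v - insert v X \<subseteq> V" using Suc.prems nbs by auto
  have inj: "inj_on f (N v - insert v X)" using assms(1) sub(2) by (rule inj_on_subset)
  have "f ` (N v - insert v X) = N (f v) - insert (f v) (f ` X)"
    using inj_on_image_set_diff[OF assms(1), of "N v" "insert v X"] nbs[OF Suc.prems(2)] sub(1) by auto
  then have "saws N (f ` X) (f v) (Suc n) =
      (\<Sum>w\<in>f ` (N v - insert v X). saws N (f ` insert v X) w n)" by simp
  also have "\<dots> = (\<Sum>w\<in>N v - insert v X. saws N (f ` insert v X) (f w) n)"
    using inj by (simp add: sum.reindex)
  also have "\<dots> = (\<Sum>w\<in>N v - insert v X. saws N (insert v X) w n)"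
    using sub by (intro sum.cong refl Suc.IH) auto
  finally show ?case by simp
qed simp

lemma saws_antimono:
  assumes "X \<subseteq> Y" "v \<in> V" and nbs: "\<And>v. v \<in> V \<Longrightarrow> N v \<subseteq> V \<and> finite (N v)"
  shows "saws N Y v n \<le> saws N X v n"
  using assms(1,2)
proof (induction n arbitrary: X Y v)
  case (Suc n)
  have "saws N Y v (Suc n) \<le> (\<Sum>w\<in>N v - insert v Y. saws N (insert v X) w n)"
    unfolding saws.simps using Suc.prems nbs by (intro sum_mono Suc.IH) auto
  also have "\<dots> \<le> saws N X v (Suc n)"
    using Suc.prems nbs by (auto intro!: sum_mono2)
  finally show ?case .
qed simp

context transitive_cubic
begin

lemma finite_nbs: "v \<in> V \<Longrightarrow> finite (N v)"
  using card_nbs by (auto intro: card_ge_0_finite)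

lemma saws_mono: "X \<subseteq> Y \<Longrightarrow> v \<in> V \<Longrightarrow> saws N Y v n \<le> saws N X v n"
  using nbs_in finite_nbs by (intro saws_antimono) auto

lemma saws_base_indep:
  assumes "u \<in> V" "v \<in> V"
  shows "saws N {} u n = saws N {} v n"
proof -
  obtain f where f: "bij_betw f V V" "\<forall>x\<in>V. N (f x) = f ` N x" "f u = v"
    using transitive[OF assms] by blast
  have "saws N (f ` {}) (f u) n = saws N {} u n"
    using f(1,2) nbs_in assms by (intro saws_image[of f V]) (auto simp: bij_betw_def)
  then show ?thesis using f(3) by simp
qed

text \<open>Cut the walk after \<open>m\<close> steps: forgetting the vertices visited so far can
  only increase the number of continuations, and transitivity lets these be counted from any fixed
  \<open>u\<close>.\<close>

lemma saws_add_le: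
  assumes "v \<in> V" "u \<in> V"
  shows "saws N X v (m + n) \<le> saws N X v m * saws N {} u n"
  using assms(1)
proof (induction m arbitrary: X v)
  case 0
  then show ?case using saws_mono[of "{}" X v n] saws_base_indep[OF 0 assms(2)] by simp
next
  case (Suc m)
  have "saws N X v (Suc m + n) \<le>
      (\<Sum>w\<in>N v - insert v X. saws N (insert v X) w m * saws N {} u n)"
    using Suc nbs_in by (auto intro!: sum_mono)
  then show ?case by (simp add: sum_distrib_right)
qed

lemma saws_root_convergent:
  assumes "v \<in> V" "\<And>n. saws N {} v n \<ge> 1"
  shows "convergent (\<lambda>n. root n (real (saws N {} v n)))"
proof (rule submultiplicative_root_convergent)
  show "1 \<le> real (saws N {} v n)" for n using assms(2)[of n] by linarith
  show "real (saws N {} v (m + n)) \<le> real (saws N {} v m) * real (saws N {} v n)" for m n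
    using saws_add_le[OF assms(1,1), of "{}" m n] by (metis of_nat_le_iff of_nat_mult)
qed

section \<open>Edge boundaries of finite vertex sets\<close>

definition boundary :: "'a set \<Rightarrow> ('a \<times> 'a) set" where
  "boundary F = {(x, y). x \<in> F \<and> y \<in> N x \<and> y \<notin> F}"

lemma boundary_nonempty:
  assumes "finite F" "F \<subseteq> V" "F \<noteq> {}"
  shows "boundary F \<noteq> {}"
proof
  assume "boundary F = {}"
  then have "F = V" using assms by (intro closed_eq) (auto simp: boundary_def)
  then show False using assms(1) inf by simp
qed

text \<open>
  A smallest finite set with one boundary arc and its image under an automorphism that moves the
  endpoint of that arc could be uncrossed, so every vertex of the set would have to be the
  endpoint.
\<close>
lemma boundary_not_single:
  assumes "finite F" "F \<subseteq> V"
  shows "card (boundary F) \<noteq> 1"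
  using assms
proof (induction "card F" arbitrary: F rule: less_induct)
  case less
  show ?case
  proof
    assume "card (boundary F) = 1"
    then obtain c d where cd: "boundary F = {(c, d)}" by (metis card_1_singletonE surj_pair)
    then have c: "c \<in> F" "d \<in> N c" "d \<notin> F" by (auto simp: boundary_def)
    have "x = c" if x: "x \<in> F" for x
    proof (rule ccontr)
      assume "x \<noteq> c"
      obtain f where f: "bij_betw f V V" "\<forall>x\<in>V. N (f x) = f ` N x" "f c = x"
        using transitive[of c x] c(1) x less.prems by blast
      have inj: "inj_on f V" using f(1) by (simp add: bij_betw_def)
      have D: "finite (f ` F)" "f ` F \<subseteq> V" "card (f ` F) = card F"
        using f(1) less.prems by (auto simp: bij_betw_def intro!: card_image inj_on_subset[OF inj])
      have bD: "boundary (f ` F) \<subseteq> {(x, f d)}"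
      proof
        fix e assume "e \<in> boundary (f ` F)"
        then obtain a z where e: "e = (f a, z)" "a \<in> F" "z \<in> N (f a)" "z \<notin> f ` F"
          by (auto simp: boundary_def)
        then obtain b where b: "b \<in> N a" "z = f b" using f(2) less.prems(2) by blast
        then have "(a, b) \<in> boundary F" using e by (auto simp: boundary_def)
        then show "e \<in> {(x, f d)}" using e b f(3) cd by auto
      qed
      let ?I = "F \<inter> f ` F" and ?U = "F \<union> f ` F"
      have I: "finite ?I" "?I \<subseteq> V" "?I \<noteq> {}" using less.prems x f(3) c(1) by auto
      have U: "finite ?U" "?U \<subseteq> V" "?U \<noteq> {}" using less.prems x D by auto
      have "boundary ?I \<union> boundary ?U \<subseteq> boundary F \<union> boundary (f ` F)"
        by (auto simp: boundary_def)
      then have sub: "boundary ?I \<union> boundary ?U \<subseteq> {(c, d), (x, f d)}" using cd bD by auto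
      have "boundary ?I \<inter> boundary ?U \<subseteq> boundary F \<inter> boundary (f ` F)"
        by (auto simp: boundary_def)
      then have disj: "boundary ?I \<inter> boundary ?U = {}" using cd bD \<open>x \<noteq> c\<close> by auto
      have "card (boundary ?I) + card (boundary ?U) = card (boundary ?I \<union> boundary ?U)"
        using disj sub by (intro card_Un_disjoint[symmetric]) (auto intro: finite_subset)
      also have "\<dots> \<le> 2" using card_mono[OF _ sub] by (simp add: card_insert_if split: if_splits)
      finally have "card (boundary ?I) + card (boundary ?U) \<le> 2" .
      moreover have "card (boundary ?I) > 0" "card (boundary ?U) > 0"
        using sub boundary_nonempty[OF I] boundary_nonempty[OF U]
        by (auto simp: card_gt_0_iff intro: finite_subset)
      \<comment> \<open>Two nonempty boundaries share at most two arcs. Minimality of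
        \<open>F\<close> then leaves no room for a smaller intersection.\<close>
      ultimately have "card (boundary ?I) = 1" by linarith
      then have "\<not> card ?I < card F" using less.hyps[OF _ I(1,2)] by blast
      then have "?I = F"
        using less.prems(1) card_mono[of F ?I] by (intro card_subset_eq) auto
      then have "F = f ` F" using D by (intro card_subset_eq) auto
      then show False using cd bD \<open>x \<noteq> c\<close> by auto
    qed
    then have "F = {c}" using c by blast
    then have "boundary F = Pair c ` N c" using nbs_irrefl by (auto simp: boundary_def)
    then have "card (boundary F) = 3"
      using card_nbs c(1) less.prems by (auto simp: card_image inj_on_def)
    then show False using cd by simp
  qed
qed

end

section \<open>Triangles and the upper bound\<close>

context transitive_cubic
begin

lemma saws_Suc_le1:
  assumes "N v - insert v X \<subseteq> {y}"
  shows "saws N X v (Suc n) \<le> saws N (insert v X) y n"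
proof -
  have "saws N X v (Suc n) \<le> (\<Sum>w\<in>{y}. saws N (insert v X) w n)"
    unfolding saws.simps using assms by (intro sum_mono2) auto
  then show ?thesis by simp
qed

lemma saws_Suc_le2:
  assumes "N v - insert v X \<subseteq> {y, z}" "y \<noteq> z"
  shows "saws N X v (Suc n) \<le> saws N (insert v X) y n + saws N (insert v X) z n"
proof -
  have "saws N X v (Suc n) \<le> (\<Sum>w\<in>{y, z}. saws N (insert v X) w n)"
    unfolding saws.simps using assms(1) by (intro sum_mono2) auto
  then show ?thesis using assms(2) by simp
qed

lemma saws_Suc_ge1:
  assumes "v \<in> V" "y \<in> N v - insert v X"
  shows "saws N X v (Suc n) \<ge> saws N (insert v X) y n"
proof -
  have "(\<Sum>w\<in>{y}. saws N (insert v X) w n) \<le> saws N X v (Suc n)"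
    unfolding saws.simps using assms finite_nbs by (intro sum_mono2) auto
  then show ?thesis by simp
qed

lemma saws_Suc_ge2:
  assumes "v \<in> V" "y \<in> N v - insert v X" "z \<in> N v - insert v X" "y \<noteq> z"
  shows "saws N X v (Suc n) \<ge> saws N (insert v X) y n + saws N (insert v X) z n"
proof -
  have "(\<Sum>w\<in>{y, z}. saws N (insert v X) w n) \<le> saws N X v (Suc n)"
    unfolding saws.simps using assms finite_nbs by (intro sum_mono2) auto
  then show ?thesis using assms(4) by simp
qed

text \<open>A crude bound that settles the short walks at the base of the inductions below.\<close>

lemma saws_le_power: "v \<in> V \<Longrightarrow> saws N X v n \<le> 3 ^ n"
proof (induction n arbitrary: X v)
  case (Suc n)
  have "saws N X v (Suc n) \<le> card (N v - insert v X) * 3 ^ n"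
    unfolding saws.simps using Suc nbs_in by (intro sum_bounded_above[THEN order_trans]) auto
  also have "\<dots> \<le> 3 * 3 ^ n"
    using card_mono[OF finite_nbs[OF Suc.prems], of "N v - insert v X"] card_nbs[OF Suc.prems]
    by (intro mult_right_mono) auto
  finally show ?case by simp
qed simp

lemma nbs_eq:
  assumes "v \<in> V" "x \<in> N v" "y \<in> N v" "z \<in> N v" "distinct [x, y, z]"
  shows "N v = {x, y, z}"
proof (rule card_subset_eq[symmetric])
  show "card {x, y, z} = card (N v)" using assms card_nbs by auto
qed (use assms finite_nbs in auto)

text \<open>
  By transitivity every vertex has a neighbour that is adjacent to the two others, which makes
  the component a \<open>K\<^sub>4\<close>.
\<close>
lemma no_two_triangles:
  assumes v: "v \<in> V" "N v = {x, y, z}" "distinct [x, y, z]"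
    and x: "y \<in> N x" "z \<in> N x"
  shows False
proof -
  have V: "x \<in> V" "y \<in> V" "z \<in> V" using v nbs_in by auto
  have nx: "N x = {v, y, z}"
    using v x V nbs_irrefl nbs_sym[of v x] by (intro nbs_eq) auto
  have ny: "v \<in> N y" "x \<in> N y" and nz: "v \<in> N z" "x \<in> N z"
    using v x V nbs_sym by auto
  obtain f where f: "bij_betw f V V" "\<forall>x\<in>V. N (f x) = f ` N x" "f v = y"
    using transitive[OF v(1) V(2)] by blast
  have inj: "inj_on f V" using f(1) by (simp add: bij_betw_def)
  have fN: "N y = {f x, f y, f z}" "f y \<in> N (f x)" "f z \<in> N (f x)"
    using f v x V by auto
  have dist: "distinct [f x, f y, f z]" using v(3) inj V by (auto dest: inj_onD)
  obtain y' where y': "N y = {v, x, y'}" "distinct [v, x, y']"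
    using fN(1) ny dist v(1) nbs_irrefl[of v] v(2) by auto (metis insert_commute)+
  have y'V: "y' \<in> V" using nbs_in[OF V(2)] y'(1) by auto
  have neq: "y' \<noteq> y" using nbs_irrefl[of y] y'(1) by auto
  have "v \<in> {f x, f y, f z}" "y' \<in> {f x, f y, f z}" using fN(1) y'(1) by auto
  then have mem: "v = f x \<or> v = f y \<or> v = f z" "y' = f x \<or> y' = f y \<or> y' = f z" by auto
  \<comment> \<open>The vertex \<open>f x\<close> is adjacent to the two other neighbours of
    \<open>y\<close>. Wherever it lies, this makes \<open>y'\<close> adjacent to \<open>v\<close> or
    to \<open>x\<close>, whose neighbours are known.\<close>
  consider "f x = v" | "f x = x" | "f x = y'" using fN(1) y'(1) by auto
  then have "y' = z"
  proof cases
    case 1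
    then have "y' \<in> N v" using fN(2,3) mem(2) y'(2) by auto
    then show ?thesis using v(2) y'(2) neq by auto
  next
    case 2
    then have "y' \<in> N x" using fN(2,3) mem(2) y'(2) by auto
    then show ?thesis using nx y'(2) neq by auto
  next
    case 3
    then have "v \<in> N y'" using fN(2,3) mem(1) y'(2) by auto
    then have "y' \<in> N v" using nbs_sym[OF y'V] by auto
    then show ?thesis using v(2) y'(2) neq by auto
  qed
  then have ny: "N y = {v, x, z}" using y' by simp
  have "y \<in> N z" using nbs_sym[OF V(2), of z] ny by auto
  then have "N z = {v, x, y}"
    using nz V v nbs_irrefl[of v] by (intro nbs_eq) auto
  \<comment> \<open>The four vertices are closed under neighbours, which contradicts that the graph
    is infinite.\<close>
  then have "{v, x, y, z} = V"
    using v V nx ny by (intro closed_eq) auto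
  then show False using inf by (metis finite.emptyI finite.insertI)
qed

text \<open>An automorphism carries the given triangle to one at \<open>x\<close>. If the third
  neighbour \<open>x'\<close> were adjacent to \<open>y\<close> or \<open>z\<close>, then that
  vertex would be joined to both other neighbours of \<open>x\<close>, against
  \<open>no_two_triangles\<close>.\<close>

lemma triangle_structure:
  assumes "u \<in> V" "v \<in> N u" "w \<in> N u" "w \<in> N v" "x \<in> V"
  shows "\<exists>x' y z. N x = {x', y, z} \<and> distinct [x', y, z] \<and> z \<in> N y \<and> y \<notin> N x' \<and> z \<notin> N x'"
proof -
  obtain f where f: "bij_betw f V V" "\<forall>x\<in>V. N (f x) = f ` N x" "f u = x"
    using transitive[OF assms(1,5)] by blast
  define y z where "y = f v" and "z = f w"
  have yz: "y \<in> N x" "z \<in> N x" "z \<in> N y"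
    using f assms nbs_in by (auto simp: y_def z_def)
  then have neq: "y \<noteq> z" using nbs_irrefl by auto
  have "card (N x - {y, z}) = 1"
    using card_nbs[OF assms(5)] yz neq by (subst card_Diff_subset) auto
  then obtain x' where "N x - {y, z} = {x'}" by (rule card_1_singletonE)
  then have N: "N x = {x', y, z}" "distinct [x', y, z]" using yz neq by auto
  have V: "x' \<in> V" "y \<in> V" "z \<in> V" using N nbs_in[OF assms(5)] by auto
  have "y \<notin> N x'"
    using no_two_triangles[of x y x' z] N yz V assms(5) nbs_sym[of x' y] by (auto simp: insert_commute)
  moreover have "z \<notin> N x'"
    using no_two_triangles[of x z x' y] N yz V assms(5) nbs_sym[of x' z] nbs_sym[of y z]
    by (auto simp: insert_commute)
  ultimately show ?thesis using N yz by blast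
qed

end

text \<open>Every vertex lies in exactly one triangle and \<open>out v\<close> is the neighbour of \<open>v\<close> outside it.\<close>
locale triangle_cubic = transitive_cubic +
  fixes out :: "'a \<Rightarrow> 'a"
  assumes out: "v \<in> V \<Longrightarrow> \<exists>y z. N v = {out v, y, z} \<and> distinct [out v, y, z] \<and>
    z \<in> N y \<and> y \<notin> N (out v) \<and> z \<notin> N (out v)"
begin

lemma out_nbs: "v \<in> V \<Longrightarrow> out v \<in> N v"
  using out[of v] by blast

lemma out_in: "v \<in> V \<Longrightarrow> out v \<in> V"
  using out_nbs nbs_in by blast

text \<open>Otherwise \<open>v\<close> would belong to the triangle at \<open>out v\<close>, whose
  third vertex would be a common neighbour of \<open>v\<close> and \<open>out v\<close>.\<close>

lemma out_out:
  assumes "v \<in> V"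
  shows "out (out v) = v"
proof (rule ccontr)
  assume neq: "out (out v) \<noteq> v"
  let ?x = "out v"
  have x: "?x \<in> V" "v \<in> N ?x" using assms out_in out_nbs nbs_sym by auto
  obtain y z where v: "N v = {?x, y, z}" "y \<notin> N ?x" "z \<notin> N ?x" using out[OF assms] by blast
  obtain p q where pq: "N ?x = {out ?x, p, q}" "q \<in> N p" using out[OF x(1)] by blast
  then have "p \<in> N q" using nbs_sym[of p q] nbs_in[OF x(1)] by auto
  then obtain q' where "q' \<in> N ?x" "q' \<in> N v" using pq x(2) neq by auto
  then show False using v nbs_irrefl[of ?x] by auto
qed

text \<open>Makes all three neighbourhoods of a triangle explicit. The outer neighbour of
  \<open>y\<close> is not \<open>v\<close> because \<open>out\<close> is an involution, and not
  \<open>z\<close> because \<open>v\<close> is a common neighbour of \<open>y\<close> and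
  \<open>z\<close>.\<close>

lemma triangleE:
  assumes "v \<in> V"
  obtains y z where "y \<in> V" "z \<in> V" "N v = {out v, y, z}" "N y = {out y, v, z}" "N z = {out z, v, y}"
    "distinct [v, y, z, out v]" "distinct [v, y, z, out y]" "distinct [v, y, z, out z]"
proof -
  have other: "N y = {out y, v, z} \<and> distinct [v, y, z, out y]"
    if N: "N v = {out v, y, z}" "distinct [out v, y, z]" and yz: "z \<in> N y" for y z
  proof -
    have V: "y \<in> V" "z \<in> V" using N nbs_in[OF assms] by auto
    have vy: "v \<in> N y" "v \<in> N z" using N assms nbs_sym by auto
    have neq: "v \<noteq> y" "v \<noteq> z" "y \<noteq> z" using N(2) vy yz nbs_irrefl by auto
    obtain p q where pq: "N y = {out y, p, q}" "distinct [out y, p, q]"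
      "p \<notin> N (out y)" "q \<notin> N (out y)"
      using out[OF V(1)] by blast
    have "out y \<noteq> v" using out_out[OF V(1)] N by auto
    moreover have "out y \<noteq> z"
      using pq vy neq by auto
    ultimately show ?thesis
      using V vy yz neq out_nbs[OF V(1)] nbs_irrefl[of y] by (intro conjI nbs_eq) auto
  qed
  obtain y z where yz: "N v = {out v, y, z}" "distinct [out v, y, z]" "z \<in> N y"
    using out[OF assms] by blast
  have V: "y \<in> V" "z \<in> V" using yz nbs_in[OF assms] by auto
  have "y \<in> N z" using nbs_sym[OF V(1) yz(3)] .
  then have "N z = {out z, v, y} \<and> distinct [v, z, y, out z]"
    using yz by (intro other) auto
  moreover have "v \<noteq> out v" using out_nbs[OF assms] nbs_irrefl by metis
  ultimately show ?thesis using other[OF yz] yz V by (intro that[of y z]) auto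
qed

text \<open>With \<open>v\<close> already visited, the walk either leaves at \<open>y\<close> at
  once or moves on to \<open>z\<close> and has to leave there. The growth bound is a hypothesis so
  that it can be an induction hypothesis as well as a proved lemma.\<close>

lemma saws_within_triangle_le:
  fixes x :: real
  assumes bound: "\<And>w Y j. j \<le> Suc k \<Longrightarrow> w \<in> V \<Longrightarrow> out w \<in> Y \<Longrightarrow> saws N Y w j \<le> 9 * x ^ j"
    and "v \<in> X" "y \<in> V" "z \<in> V" "N y = {out y, v, z}" "N z = {out z, v, y}" "out y \<noteq> z"
  shows "saws N X y (Suc (Suc k)) \<le> 9 * x ^ Suc k + 9 * x ^ k"
proof -
  have "saws N X y (Suc (Suc k)) \<le>
      saws N (insert y X) (out y) (Suc k) + saws N (insert y X) z (Suc k)"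
    using assms by (intro saws_Suc_le2) auto
  also have "saws N (insert y X) z (Suc k) \<le> saws N (insert z (insert y X)) (out z) k"
    using assms by (intro saws_Suc_le1) auto
  finally have "real (saws N X y (Suc (Suc k))) \<le>
      real (saws N (insert y X) (out y) (Suc k)) +
      real (saws N (insert z (insert y X)) (out z) k)" by linarith
  also have "\<dots> \<le> 9 * x ^ Suc k + 9 * x ^ k"
    using assms out_in out_out by (intro add_mono bound) auto
  finally show ?thesis .
qed

text \<open>The cubic equation is the equation of the upper bound with denominators cleared; it
  makes \<open>9 * x ^ n\<close> satisfy the recursion with equality. The factor
  \<open>9 = 3 ^ 2\<close> covers \<open>n < 3\<close>. The condition \<open>out v \<in> X\<close>
  says that the triangle was entered through its outer edge.\<close>

lemma saws_after_out_le:
  fixes x :: real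
  assumes x: "1 < x" "x ^ 3 = 2 * x + 2" and "v \<in> V" "out v \<in> X"
  shows "saws N X v n \<le> 9 * x ^ n"
  using assms(3,4)
proof (induction n arbitrary: X v rule: less_induct)
  case (less n)
  show ?case
  proof (cases "n < 3")
    case True
    have "saws N X v n \<le> 3 ^ n" using saws_le_power less.prems by blast
    also have "(3::nat) ^ n \<le> 3 ^ 2" using True by (intro power_increasing) auto
    finally have "real (saws N X v n) \<le> 9" by simp
    also have "\<dots> \<le> 9 * x ^ n" using x(1) by (simp add: one_le_power)
    finally show ?thesis .
  next
    case False
    then have "n = Suc (Suc (Suc (n - 3)))" by linarith
    then obtain k where k: "n = Suc (Suc (Suc k))" by blast
    obtain y z where yz: "y \<in> V" "z \<in> V" "N v = {out v, y, z}" "N y = {out y, v, z}"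
      "N z = {out z, v, y}"
      and dist: "distinct [v, y, z, out v]" "distinct [v, y, z, out y]" "distinct [v, y, z, out z]"
      using triangleE[OF less.prems(1)] by metis
    have "saws N X v n \<le> saws N (insert v X) y (Suc (Suc k)) + saws N (insert v X) z (Suc (Suc k))"
      unfolding k using yz dist less.prems by (intro saws_Suc_le2) auto
    then have "real (saws N X v n) \<le>
        real (saws N (insert v X) y (Suc (Suc k))) + real (saws N (insert v X) z (Suc (Suc k)))"
      by linarith
    also have "\<dots> \<le> (9 * x ^ Suc k + 9 * x ^ k) + (9 * x ^ Suc k + 9 * x ^ k)"
      using yz dist k less.IH
      by (intro add_mono saws_within_triangle_le[of k x v _ y z] saws_within_triangle_le[of k x v _ z y]) auto
    also have "\<dots> = 9 * (x ^ k * x ^ 3)" unfolding x(2) by (simp add: algebra_simps)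
    also have "\<dots> = 9 * x ^ n" by (simp add: k numeral_3_eq_3)
    finally show ?thesis .
  qed
qed

text \<open>The first vertex has no predecessor, so there are three directions: 9 for the outer edge
  and 18 for each of the two triangle edges, 45 in total.\<close>

lemma saws_le:
  fixes x :: real
  assumes x: "1 < x" "x ^ 3 = 2 * x + 2" and v: "v \<in> V"
  shows "saws N {} v n \<le> 45 * x ^ n"
proof (cases n)
  case (Suc m)
  obtain y z where yz: "y \<in> V" "z \<in> V" "N v = {out v, y, z}" "N y = {out y, v, z}"
    "N z = {out z, v, y}"
    and dist: "distinct [v, y, z, out v]" "distinct [v, y, z, out y]" "distinct [v, y, z, out z]"
    using triangleE[OF v] by metis
  have side: "saws N {v} y m \<le> 18 * x ^ m"
    if "y \<in> V" "z \<in> V" "N y = {out y, v, z}" "N z = {out z, v, y}" "out y \<noteq> z" for y z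
  proof (cases "m < 2")
    case True
    have "saws N {v} y m \<le> 3 ^ m" using saws_le_power that by blast
    also have "(3::nat) ^ m \<le> 3 ^ 1" using True by (intro power_increasing) auto
    finally have "real (saws N {v} y m) \<le> 18" by simp
    also have "\<dots> \<le> 18 * x ^ m" using x(1) by (simp add: one_le_power)
    finally show ?thesis .
  next
    case False
    then have "m = Suc (Suc (m - 2))" by linarith
    then obtain k where k: "m = Suc (Suc k)" by blast
    have "saws N {v} y m \<le> 9 * x ^ Suc k + 9 * x ^ k"
      unfolding k using that saws_after_out_le[OF x] by (intro saws_within_triangle_le[of k x v _ y z]) auto
    also have "\<dots> \<le> 9 * x ^ m + 9 * x ^ m"
      using x(1) by (intro add_mono mult_left_mono power_increasing) (auto simp: k)
    finally show ?thesis by simp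
  qed
  have "out v \<noteq> y" "out v \<noteq> z" "out v \<noteq> v" using dist by auto
  then have "saws N {} v n = saws N {v} (out v) m + (saws N {v} y m + saws N {v} z m)"
    using yz dist by (simp add: Suc)
  then have "real (saws N {} v n) =
      real (saws N {v} (out v) m) + (real (saws N {v} y m) + real (saws N {v} z m))" by simp
  also have "\<dots> \<le> 9 * x ^ m + (18 * x ^ m + 18 * x ^ m)"
    using yz dist v out_in out_out
    by (intro add_mono side[of y z] side[of z y] saws_after_out_le[OF x]) auto
  also have "\<dots> \<le> 45 * x ^ n" using x(1) by (simp add: Suc)
  finally show ?thesis .
qed simp

end

section \<open>Escaping walks and the lower bound\<close>

context transitive_cubic
begin

inductive_set reach :: "'a set \<Rightarrow> 'a \<Rightarrow> 'a set" for S v where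
  refl: "v \<in> reach S v"
| step: "x \<in> reach S v \<Longrightarrow> x \<notin> S \<Longrightarrow> y \<in> N x \<Longrightarrow> y \<notin> S \<Longrightarrow> y \<in> reach S v"

text \<open>
  A vertex of \<open>S\<close> reaches only itself, so \<open>escaping S\<close> is the union of the infinite components
  that remain when \<open>S\<close> is removed.
\<close>
definition escaping :: "'a set \<Rightarrow> 'a set" where
  "escaping S = {v \<in> V. infinite (reach S v)}"

definition potential :: "'a set \<Rightarrow> nat" where
  "potential S = card {(u, v). u \<in> S \<and> v \<in> N u \<and> v \<in> escaping S}"

lemma reach_subset:
  assumes "v \<in> W" "\<And>x y. x \<in> W \<Longrightarrow> x \<notin> S \<Longrightarrow> y \<in> N x \<Longrightarrow> y \<notin> S \<Longrightarrow> y \<in> W"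
  shows "reach S v \<subseteq> W"
proof
  fix x assume "x \<in> reach S v"
  then show "x \<in> W" using assms by induction auto
qed

lemma reach_in: "v \<in> V \<Longrightarrow> reach S v \<subseteq> V"
  using nbs_in by (intro reach_subset) auto

lemma reach_trans: "x \<in> reach S v \<Longrightarrow> reach S x \<subseteq> reach S v"
  by (intro reach_subset) (auto intro: reach.step)

lemma reach_avoids:
  assumes "v \<notin> S" "x \<in> reach S v"
  shows "x \<notin> S"
  using assms(2,1) by induction auto

lemma reach_sym:
  assumes "v \<in> V" "x \<in> reach S v"
  shows "v \<in> reach S x"
  using assms(2)
proof induction
  case (step x y)
  have x: "x \<in> V" using step assms(1) reach_in by blast
  then have "x \<in> reach S y"
    using step nbs_sym nbs_in by (blast intro: reach.intros)
  then show ?case using reach_trans step by blast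
qed (rule reach.refl)

lemma reach_antimono: "S \<subseteq> S' \<Longrightarrow> reach S' v \<subseteq> reach S v"
  by (intro reach_subset) (auto intro: reach.intros)

lemma reach_self: "v \<in> S \<Longrightarrow> reach S v = {v}"
  using reach_subset[of v "{v}" S] reach.refl[of v S] by auto

lemma escaping_not_in: "v \<in> escaping S \<Longrightarrow> v \<notin> S"
  using reach_self[of v S] by (auto simp: escaping_def)

lemma escaping_in: "escaping S \<subseteq> V"
  by (auto simp: escaping_def)

lemma escaping_antimono: "S \<subseteq> S' \<Longrightarrow> escaping S' \<subseteq> escaping S"
  using reach_antimono[of S S'] by (auto simp: escaping_def dest: finite_subset)

lemma escaping_reach_iff:
  assumes "v \<in> V" "x \<in> reach S v"
  shows "x \<in> escaping S \<longleftrightarrow> v \<in> escaping S"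
proof -
  have "reach S x = reach S v" using reach_trans reach_sym[OF assms] assms(2) by blast
  then show ?thesis using assms reach_in by (auto simp: escaping_def)
qed

lemma finite_arcs_from:
  assumes "finite S" "S \<subseteq> V"
  shows "finite {(u, v). u \<in> S \<and> v \<in> N u \<and> P u v}"
proof (rule finite_subset)
  show "finite (Sigma S N)" using assms finite_nbs by blast
qed auto

end

section \<open>The potential along one passage through a triangle\<close>

context triangle_cubic
begin

text \<open>If both exits were dead ends, the component of \<open>a\<close> would be covered by the
  triangle and two finite pieces; the third exit \<open>out a\<close> is blocked.\<close>

lemma escaping_exit_exists:
  assumes a: "a \<in> escaping S" "out a \<in> S"
    and N: "N a = {out a, b, c}" "N b = {out b, a, c}" "N c = {out c, a, b}"
  shows "out b \<in> escaping (S \<union> {a, b, c}) \<or> out c \<in> escaping (S \<union> {a, b, c})"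
proof (rule ccontr)
  assume contr: "\<not> ?thesis"
  let ?S = "S \<union> {a, b, c}"
  have aV: "a \<in> V" using a escaping_in by blast
  then have V: "b \<in> V" "c \<in> V" using N(1) nbs_in[OF aV] by auto
  have "finite (reach ?S (out b))" "finite (reach ?S (out c))"
    using contr V out_in by (auto simp: escaping_def)
  moreover have "reach S a \<subseteq> {a, b, c} \<union> reach ?S (out b) \<union> reach ?S (out c)"
  proof (rule reach_subset)
    fix x y assume x: "x \<in> {a, b, c} \<union> reach ?S (out b) \<union> reach ?S (out c)"
      and y: "x \<notin> S" "y \<in> N x" "y \<notin> S"
    show "y \<in> {a, b, c} \<union> reach ?S (out b) \<union> reach ?S (out c)"
    proof (cases "x \<in> {a, b, c}")
      case True
      then show ?thesis using N y a(2) by (auto intro: reach.refl)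
    next
      case False
      then show ?thesis using x y by (auto intro: reach.step)
    qed
  qed simp
  ultimately have "finite (reach S a)" by (auto intro: finite_subset)
  then show False using a(1) by (simp add: escaping_def)
qed

text \<open>
  If the exit \<open>c\<close> of the new triangle is a dead end, then a further arc of \<open>S\<close> is used up:
  either \<open>c\<close> is adjacent to \<open>S\<close>, or \<open>S\<close> is adjacent to the finite component behind \<open>c\<close>,
  which would otherwise have only one boundary arc.
\<close>
lemma dead_exit_arc:
  assumes S: "a \<in> escaping S" "out a \<in> S"
    and N: "N a = {out a, b, c}" "N b = {out b, a, c}" "N c = {out c, a, b}"
    and dist: "distinct [a, b, c, out c]" and disj: "b \<notin> S" "c \<notin> S"
    and b: "out b \<in> escaping (S \<union> {a, b, c})" and c: "out c \<notin> escaping (S \<union> {a, b, c})"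
  obtains u v where "u \<in> S" "v \<in> N u" "v \<in> escaping S" "v \<notin> escaping (S \<union> {a, b, c})"
    "v \<noteq> a"
proof -
  let ?S = "S \<union> {a, b, c}"
  have aV: "a \<in> V" using S(1) escaping_in by blast
  then have V: "b \<in> V" "c \<in> V" using N(1) nbs_in[OF aV] by auto
  have cr: "c \<in> reach S a"
    using reach.step[OF reach.refl, of a S c] N disj S(1) escaping_not_in by auto
  show thesis
  proof (cases "out c \<in> S")
    case True
    show thesis
    proof (rule that[OF True])
      show "c \<in> N (out c)" using nbs_sym[OF V(2) out_nbs[OF V(2)]] .
      show "c \<in> escaping S" using escaping_reach_iff[OF aV cr] S(1) by simp
      show "c \<notin> escaping ?S" using escaping_not_in by blast
    qed (use dist in auto)
  next
    case False
    \<comment> \<open>The finite component behind the dead exit.\<close>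
    define F where "F = reach ?S (out c)"
    have ocV: "out c \<in> V" using V out_in by blast
    have oc: "out c \<notin> ?S" using False dist by auto
    have F: "finite F" "F \<subseteq> V"
      using c ocV reach_in by (auto simp: F_def escaping_def)
    have F_not: "x \<notin> ?S" if "x \<in> F" for x using reach_avoids[OF oc] that by (simp add: F_def)
    have "out c \<in> reach S a"
      using reach.step[OF cr, of "out c"] N disj False by auto
    then have FS: "F \<subseteq> reach S a"
      using reach_antimono[of S ?S "out c"] reach_trans[of "out c" S a] by (auto simp: F_def)
    have F_esc: "x \<in> escaping S" "x \<notin> escaping ?S" if "x \<in> F" for x
      using that escaping_reach_iff[OF aV, of x S] escaping_reach_iff[OF ocV, of x ?S] FS S(1) c
      by (auto simp: F_def)
    have ocN: "c \<in> N (out c)" using nbs_sym[OF V(2) out_nbs[OF V(2)]] .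
    have "\<exists>x\<in>F. \<exists>y\<in>N x. y \<in> S"
    proof (rule ccontr)
      assume no: "\<not> ?thesis"
      have "boundary F = {(out c, c)}"
      proof (intro equalityI subsetI)
        fix e assume "e \<in> boundary F"
        then obtain x y where e: "e = (x, y)" "x \<in> F" "y \<in> N x" "y \<notin> F"
          by (auto simp: boundary_def)
        have "y \<in> ?S"
          using e F_not[OF e(2)] reach.step[of x ?S "out c" y] by (auto simp: F_def)
        then have y: "y \<in> {a, b, c}" using no e by auto
        have "x \<in> N y" using nbs_sym[of x y] e F by auto
        then have "x = out y" using y N F_not[OF e(2)] by auto
        \<comment> \<open>The outer neighbour of \<open>a\<close> lies in \<open>S\<close> and that
          of \<open>b\<close> escapes, so neither can belong to \<open>F\<close>.\<close>
        then have "y = c" using y e F_not[of x] F_esc[of x] S(2) b by auto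
        then show "e \<in> {(out c, c)}" using e \<open>x = out y\<close> by simp
      next
        fix e assume "e \<in> {(out c, c)}"
        then show "e \<in> boundary F"
          using ocN F_not[of c] by (auto simp: boundary_def F_def intro: reach.refl)
      qed
      then show False using boundary_not_single[OF F] by simp
    qed
    then obtain x y where xy: "x \<in> F" "y \<in> N x" "y \<in> S" by blast
    have "x \<in> N y" using nbs_sym[of x y] xy F by auto
    then show thesis using that[OF xy(3)] F_esc[OF xy(1)] F_not[OF xy(1)] by auto
  qed
qed

text \<open>Each live exit contributes at most one new arc, and the entry arc is lost. With two live
  exits the change is at most \<open>2 - 1\<close>; with one, \<open>dead_exit_arc\<close> costs a
  second arc and the change is at most \<open>1 - 2\<close>. Both cases read
  \<open>2 * card B - 3\<close>.\<close>

lemma potential_step: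
  assumes S: "finite S" "S \<subseteq> V" "a \<in> escaping S" "out a \<in> S"
    and N: "N a = {out a, b, c}" "N b = {out b, a, c}" "N c = {out c, a, b}"
    and dist: "distinct [a, b, c, out b]" "distinct [a, b, c, out c]"
    and disj: "b \<notin> S" "c \<notin> S"
  shows "potential (S \<union> {a, b, c}) + 3 \<le>
    potential S + 2 * card {w \<in> {b, c}. out w \<in> escaping (S \<union> {a, b, c})}"
proof -
  let ?S = "S \<union> {a, b, c}"
  define B where "B = {w \<in> {b, c}. out w \<in> escaping ?S}"
  define A where "A = {(u, v). u \<in> S \<and> v \<in> N u \<and> v \<in> escaping ?S}"
  define P where "P = {(u, v). u \<in> S \<and> v \<in> N u \<and> v \<in> escaping S}"
  have finA: "finite A" and finP: "finite P"
    unfolding A_def P_def by (rule finite_arcs_from[OF S(1,2)])+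
  have aV: "a \<in> V" using S(3) escaping_in by blast
  then have V: "b \<in> V" "c \<in> V" using N(1) nbs_in[OF aV] by auto
  have bc: "b \<noteq> c" using dist by auto
  \<comment> \<open>The vertex \<open>a\<close> gives no new arc: its outer neighbour is in
    \<open>S\<close> and its other neighbours are in the triangle.\<close>
  have "{(u, v). u \<in> ?S \<and> v \<in> N u \<and> v \<in> escaping ?S} \<subseteq> A \<union> (\<lambda>w. (w, out w)) ` B"
    using N escaping_not_in[of _ ?S] S(4) by (auto simp: A_def B_def)
  then have "potential ?S \<le> card (A \<union> (\<lambda>w. (w, out w)) ` B)"
    unfolding potential_def using finA by (intro card_mono) (auto simp: B_def)
  also have "\<dots> \<le> card A + card B"
    using card_Un_le[of A "(\<lambda>w. (w, out w)) ` B"] card_image_le[of B "\<lambda>w. (w, out w)"]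
    by (simp add: B_def)
  finally have 1: "potential ?S \<le> card A + card B" .
  have AP: "A \<subseteq> P" using escaping_antimono[of S ?S] by (auto simp: A_def P_def)
  have aP: "(out a, a) \<in> P - A"
    using S nbs_sym[OF aV out_nbs[OF aV]] escaping_not_in[of a ?S] by (auto simp: P_def A_def)
  have one: "card A + 1 \<le> card P"
    using card_mono[OF finP, of "insert (out a, a) A"] aP AP finA by auto
  have two: "card A + 2 \<le> card P" if "(u, v) \<in> P - A" "v \<noteq> a" for u v
    using card_mono[OF finP, of "insert (u, v) (insert (out a, a) A)"] that aP AP finA by auto
  have P: "potential S = card P" by (simp add: potential_def P_def)
  have B: "B = (if out b \<in> escaping ?S then {b} else {}) \<union> (if out c \<in> escaping ?S then {c} else {})"
    by (auto simp: B_def)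
  have "out b \<in> escaping ?S \<or> out c \<in> escaping ?S"
    using S(3,4) N by (rule escaping_exit_exists)
  then consider "out b \<in> escaping ?S" "out c \<in> escaping ?S"
    | "out b \<in> escaping ?S" "out c \<notin> escaping ?S"
    | "out c \<in> escaping ?S" "out b \<notin> escaping ?S" by blast
  then have "card A + card B + 3 \<le> card P + 2 * card B"
  proof cases
    case 1
    then have "card B = 2" using B bc by simp
    then show ?thesis using one by simp
  next
    case 2
    have "distinct [a, b, c, out c]" using dist by simp
    from S(3,4) N this disj 2 obtain u v where "u \<in> S" "v \<in> N u" "v \<in> escaping S"
      "v \<notin> escaping ?S" "v \<noteq> a" by (rule dead_exit_arc)
    then have "card A + 2 \<le> card P" by (intro two[of u v]) (auto simp: A_def P_def)
    moreover have "card B = 1" using B 2 by simp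
    ultimately show ?thesis by simp
  next
    case 3
    have eq: "S \<union> {a, c, b} = ?S" by blast
    have "N a = {out a, c, b}" "N c = {out c, a, b}" "N b = {out b, a, c}" "distinct [a, c, b, out b]"
      using N dist by auto
    from S(3,4) this disj(2,1) 3 obtain u v where "u \<in> S" "v \<in> N u" "v \<in> escaping S"
      "v \<notin> escaping ?S" "v \<noteq> a" unfolding eq[symmetric] by (rule dead_exit_arc)
    then have "card A + 2 \<le> card P" by (intro two[of u v]) (auto simp: A_def P_def)
    moreover have "card B = 1" using B 3 by simp
    ultimately show ?thesis by simp
  qed
  then show ?thesis using 1 unfolding P B_def by linarith
qed

text \<open>The two summands correspond to going around the triangle from \<open>a\<close> to \<open>w\<close> in either direction.\<close>
lemma saws_triangle_ge:
  assumes S: "a \<in> V" "a \<notin> S" "b \<notin> S" "c \<notin> S"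
    and N: "N a = {out a, b, c}" "N b = {out b, a, c}" "N c = {out c, a, b}"
    and dist: "distinct [a, b, c, out b]" "distinct [a, b, c, out c]"
    and B: "B \<subseteq> {b, c}" "\<And>w. w \<in> B \<Longrightarrow> out w \<notin> S"
  shows "saws N S a (Suc (Suc n)) \<ge> (\<Sum>w\<in>B. saws N (S \<union> {a, b, c}) (out w) n)"
    and "saws N S a (Suc (Suc (Suc n))) \<ge>
      (\<Sum>w\<in>B. saws N (S \<union> {a, b, c}) (out w) (Suc n) + saws N (S \<union> {a, b, c}) (out w) n)"
proof -
  let ?S = "S \<union> {a, b, c}"
  \<comment> \<open>The value 0 outside \<open>B\<close> treats live and dead exits
    uniformly.\<close>
  define g where "g w n = (if w \<in> B then saws N ?S (out w) n else 0)" for w n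
  have V: "b \<in> V" "c \<in> V" using N(1) nbs_in[OF S(1)] by auto
  have oV: "out b \<in> V" "out c \<in> V" using V out_in by auto
  have exit: "saws N X w (Suc n) \<ge> g w n"
    if "w \<in> {b, c}" "insert w X \<subseteq> ?S" for w X n
  proof (cases "w \<in> B")
    case True
    have "saws N ?S (out w) n \<le> saws N (insert w X) (out w) n"
      using that oV by (intro saws_mono) auto
    also have "\<dots> \<le> saws N X w (Suc n)"
      using that V B(2)[OF True] dist out_nbs by (intro saws_Suc_ge1) auto
    finally show ?thesis using True by (simp add: g_def)
  qed (simp add: g_def)
  \<comment> \<open>From \<open>w\<close> the walk leaves at once or goes around to
    \<open>w'\<close> and leaves one step later.\<close>
  have within: "saws N (insert a S) w (Suc (Suc n)) \<ge> g w (Suc n) + g w' n"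
    if w: "w \<in> {b, c}" "w' \<in> {b, c}" "w \<noteq> w'" for w w' n
  proof -
    let ?X = "insert w (insert a S)"
    have wV: "w \<in> V" and w': "w' \<in> N w - insert w (insert a S)" using w V N S dist by auto
    have "g w (Suc n) + saws N ?X w' (Suc n) \<le> saws N (insert a S) w (Suc (Suc n))"
    proof (cases "w \<in> B")
      case True
      have "saws N ?S (out w) (Suc n) \<le> saws N ?X (out w) (Suc n)"
        using w oV by (intro saws_mono) auto
      moreover have "out w \<in> N w - insert w (insert a S)" "out w \<noteq> w'"
        using w wV B(2)[OF True] dist out_nbs by auto
      ultimately show ?thesis
        using saws_Suc_ge2[OF wV _ w', of "out w" "Suc n"] True by (simp add: g_def)
    qed (use saws_Suc_ge1[OF wV w'] in \<open>simp add: g_def del: saws.simps\<close>)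
    moreover have "g w' n \<le> saws N ?X w' (Suc n)" using w by (intro exit) auto
    ultimately show ?thesis by linarith
  qed
  have sumB: "(\<Sum>w\<in>B. h w) = (\<Sum>w\<in>{b, c}. if w \<in> B then h w else 0)" for h :: "'a \<Rightarrow> nat"
    using B(1) by (intro sum.mono_neutral_cong_left) auto
  have first: "saws N S a (Suc m) \<ge> saws N (insert a S) b m + saws N (insert a S) c m" for m
    using S N dist by (intro saws_Suc_ge2) auto
  show "saws N S a (Suc (Suc n)) \<ge> (\<Sum>w\<in>B. saws N (S \<union> {a, b, c}) (out w) n)"
  proof -
    have "g b n \<le> saws N (insert a S) b (Suc n)" "g c n \<le> saws N (insert a S) c (Suc n)"
      by (rule exit; blast)+
    then show ?thesis
      using first[of "Suc n"] dist unfolding sumB g_def by (auto simp del: saws.simps split: if_splits)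
  qed
  show "saws N S a (Suc (Suc (Suc n))) \<ge>
      (\<Sum>w\<in>B. saws N (S \<union> {a, b, c}) (out w) (Suc n) + saws N (S \<union> {a, b, c}) (out w) n)"
    using first[of "Suc (Suc n)"] within[of b c n] within[of c b n] dist
    unfolding sumB g_def by (auto simp del: saws.simps split: if_splits)
qed

text \<open>Passing to an exit takes two or three steps and so has weight
  \<open>r ^ 2 + r ^ 3 = q\<close> with \<open>q = 1 / sqrt 2\<close>. By
  \<open>potential_step\<close> the total weight \<open>q ^ potential\<close> is preserved: one exit
  lowers the potential, and two exits use \<open>2 * q ^ 2 = 1\<close>. The empty walk adds at least
  \<open>q ^ potential\<close> at each level, hence the linear growth in \<open>k\<close>. The last
  hypothesis makes \<open>S\<close> a union of triangles.\<close>

lemma weighted_saws_ge: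
  fixes r :: real
  assumes r: "0 < r" "r ^ 2 + r ^ 3 = 1 / sqrt 2"
    and "finite S" "S \<subseteq> V" "a \<in> escaping S" "out a \<in> S"
    and "\<And>v w. v \<in> S \<Longrightarrow> w \<in> N v \<Longrightarrow> w \<noteq> out v \<Longrightarrow> w \<in> S"
  shows "(\<Sum>n\<le>3 * k. saws N S a n * r ^ n) \<ge> real (Suc k) * (1 / sqrt 2) ^ potential S"
  using assms(3-)
proof (induction k arbitrary: S a)
  case 0
  show ?case by (simp add: power_le_one)
next
  case (Suc k)
  define q :: real where "q = 1 / sqrt 2"
  have q: "0 < q" "q \<le> 1" "q ^ 2 = 1 / 2" by (auto simp: q_def power_divide)
  have aV: "a \<in> V" using Suc.prems(3) escaping_in by blast
  have a: "a \<notin> S" using Suc.prems(3) escaping_not_in by blast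
  obtain b c where V: "b \<in> V" "c \<in> V"
    and N: "N a = {out a, b, c}" "N b = {out b, a, c}" "N c = {out c, a, b}"
    and dist: "distinct [a, b, c, out a]" "distinct [a, b, c, out b]" "distinct [a, b, c, out c]"
    using triangleE[OF aV] by metis
  have disj: "b \<notin> S" "c \<notin> S"
    using Suc.prems(5)[of b a] Suc.prems(5)[of c a] N dist a by auto
  let ?S = "S \<union> {a, b, c}"
  define B where "B = {w \<in> {b, c}. out w \<in> escaping ?S}"
  define Z where "Z X v m = (\<Sum>n\<le>m. real (saws N X v n) * r ^ n)" for X v m
  have finB: "finite B" by (simp add: B_def)
  have BS: "out w \<notin> S" if "w \<in> B" for w using that escaping_not_in[of "out w" ?S] by (auto simp: B_def)
  have pot: "potential ?S + 3 \<le> potential S + 2 * card B"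
    unfolding B_def using Suc.prems N dist disj by (intro potential_step) auto
  have IH: "real (Suc k) * q ^ potential ?S \<le> Z ?S (out w) (3 * k)" if w: "w \<in> B" for w
    unfolding Z_def q_def
  proof (rule Suc.IH)
    show "out (out w) \<in> ?S" using w V out_out by (auto simp: B_def)
    show "v' \<in> ?S" if "v \<in> ?S" "v' \<in> N v" "v' \<noteq> out v" for v v'
      using that Suc.prems(5)[of v v'] N by auto
  qed (use w Suc.prems aV V in \<open>auto simp: B_def\<close>)
  have ge2: "saws N S a (Suc (Suc n)) \<ge> (\<Sum>w\<in>B. saws N ?S (out w) n)"
    and ge3: "saws N S a (Suc (Suc (Suc n))) \<ge>
      (\<Sum>w\<in>B. saws N ?S (out w) (Suc n) + saws N ?S (out w) n)" for n
    using aV a disj N dist(2,3) BS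
    by (intro saws_triangle_ge; force simp: B_def)+
  have "1 + (\<Sum>w\<in>B. (r ^ 2 + r ^ 3) * Z ?S (out w) (3 * k)) \<le> Z S a (3 * Suc k)"
  proof -
    define m where "m = 3 * k"
    let ?s = "\<lambda>w n. real (saws N ?S (out w) n)"
    have "3 * Suc k = Suc (Suc (Suc m))" by (simp add: m_def)
    then have "Z S a (3 * Suc k) = Z S a (Suc (Suc (Suc m)))" by (simp only:)
    moreover have "(\<Sum>n\<le>Suc (Suc (Suc m)). f n) =
        f 0 + f (Suc 0) + f (Suc (Suc 0)) + (\<Sum>n\<le>m. f (Suc (Suc (Suc n))))" for f :: "nat \<Rightarrow> real"
      by (simp only: sum.atMost_Suc_shift add.assoc)
    ultimately have Z: "Z S a (3 * Suc k) =
        1 + real (saws N S a (Suc 0)) * r + real (saws N S a (Suc (Suc 0))) * r ^ 2 +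
        (\<Sum>n\<le>m. real (saws N S a (Suc (Suc (Suc n)))) * r ^ (n + 3))"
      by (simp add: Z_def numeral_eq_Suc del: saws.simps(2) sum.atMost_Suc)
    \<comment> \<open>The coefficient of \<open>r ^ (n + 3)\<close> collects the two-step passages
      with \<open>n + 1\<close> steps left and the three-step passages with \<open>n\<close> steps
      left.\<close>
    have shift: "r ^ 2 * (\<Sum>n\<le>Suc m. t n * r ^ n) + r ^ 3 * (\<Sum>n\<le>m. t n * r ^ n) =
        t 0 * r ^ 2 + (\<Sum>n\<le>m. (t (Suc n) + t n) * r ^ (n + 3))" for t :: "nat \<Rightarrow> real"
    proof -
      have "(\<Sum>n\<le>Suc m. t n * r ^ n) = t 0 + (\<Sum>n\<le>m. t (Suc n) * r ^ Suc n)"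
        by (subst sum.atMost_Suc_shift) simp
      then show ?thesis
        by (simp add: sum_distrib_left sum.distrib algebra_simps power_add power2_eq_square
            power3_eq_cube)
    qed
    \<comment> \<open>After a two-step passage one more step is available; the extra nonnegative
      term aligns the sums with \<open>shift\<close>.\<close>
    have "(\<Sum>w\<in>B. (r ^ 2 + r ^ 3) * Z ?S (out w) m) \<le>
        (\<Sum>w\<in>B. r ^ 2 * Z ?S (out w) (Suc m) + r ^ 3 * Z ?S (out w) m)"
      using r(1) by (intro sum_mono)
        (simp add: distrib_right mult_left_mono Z_def sum.atMost_Suc del: saws.simps)
    also have "\<dots> = (\<Sum>w\<in>B. ?s w 0 * r ^ 2 + (\<Sum>n\<le>m. (?s w (Suc n) + ?s w n) * r ^ (n + 3)))"
      unfolding Z_def by (rule sum.cong[OF HOL.refl shift])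
    also have "\<dots> = (\<Sum>w\<in>B. ?s w 0) * r ^ 2 +
        (\<Sum>n\<le>m. (\<Sum>w\<in>B. ?s w (Suc n) + ?s w n) * r ^ (n + 3))"
      by (subst (2) sum_distrib_right, subst sum.swap, simp add: sum.distrib sum_distrib_right)
    also have "\<dots> \<le> real (saws N S a (Suc (Suc 0))) * r ^ 2 +
        (\<Sum>n\<le>m. real (saws N S a (Suc (Suc (Suc n)))) * r ^ (n + 3))"
    proof (intro add_mono sum_mono mult_right_mono)
      show "(\<Sum>w\<in>B. ?s w 0) \<le> real (saws N S a (Suc (Suc 0)))"
        using of_nat_mono[OF ge2[of 0], where 'a = real] by (simp del: saws.simps)
      show "(\<Sum>w\<in>B. ?s w (Suc n) + ?s w n) \<le> real (saws N S a (Suc (Suc (Suc n))))" for n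
        using of_nat_mono[OF ge3[of n], where 'a = real] by (simp del: saws.simps)
    qed (use r(1) in auto)
    also have "\<dots> \<le> Z S a (3 * Suc k) - 1"
      unfolding Z using r(1) by (simp del: saws.simps)
    finally show ?thesis by (simp add: m_def)
  qed
  moreover have "card B * (q * (real (Suc k) * q ^ potential ?S)) \<le>
      (\<Sum>w\<in>B. (r ^ 2 + r ^ 3) * Z ?S (out w) (3 * k))"
    using IH q(1) by (intro sum_bounded_below) (auto simp: r(2) q_def[symmetric] intro!: mult_left_mono)
  moreover have "q ^ potential S \<le> card B * (q * q ^ potential ?S)"
  proof -
    have pow: "q ^ (potential S + 2 * card B) \<le> q ^ (potential ?S + 3)"
      using pot q by (intro power_decreasing) auto
    have le: "q ^ potential S * (1 / 2) ^ card B \<le> q ^ potential ?S * (q / 2)"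
    proof -
      have "q ^ 3 = q / 2" using q(3) by (simp add: power3_eq_cube power2_eq_square)
      then show ?thesis using pow by (simp only: power_add power_mult q(3))
    qed
    have "out b \<in> escaping ?S \<or> out c \<in> escaping ?S"
      using Suc.prems(3,4) N by (rule escaping_exit_exists)
    then have "B \<noteq> {}" by (auto simp: B_def)
    moreover have "card B \<le> card {b, c}" by (intro card_mono) (auto simp: B_def)
    ultimately have "card B = 1 \<or> card B = 2" using finB dist by (auto simp: card_gt_0_iff le_Suc_eq)
    \<comment> \<open>For one or two exits, \<open>2 ^ card B / 2\<close> equals
      \<open>card B\<close>.\<close>
    then show ?thesis using le by (auto simp: power2_eq_square algebra_simps)
  qed
  moreover have "q ^ potential S \<le> 1" using q by (intro power_le_one) auto
  ultimately have "real (Suc (Suc k)) * q ^ potential S \<le> Z S a (3 * Suc k)"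
  proof -
    assume *: "1 + (\<Sum>w\<in>B. (r ^ 2 + r ^ 3) * Z ?S (out w) (3 * k)) \<le> Z S a (3 * Suc k)"
      "card B * (q * (real (Suc k) * q ^ potential ?S)) \<le>
        (\<Sum>w\<in>B. (r ^ 2 + r ^ 3) * Z ?S (out w) (3 * k))"
      "q ^ potential S \<le> card B * (q * q ^ potential ?S)" "q ^ potential S \<le> 1"
    have "real (Suc k) * q ^ potential S \<le> real (Suc k) * (card B * (q * q ^ potential ?S))"
      using *(3) by (intro mult_left_mono) auto
    then show ?thesis using *(1,2,4) by (simp add: algebra_simps)
  qed
  then show ?case by (simp only: Z_def q_def)
qed

end

section \<open>Bounds on the growth rate\<close>

context triangle_cubic
begin

text \<open>Were all exits of a first triangle dead ends, the whole graph would be finite. The final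
  inequality prepends the step from \<open>out a\<close> to \<open>a\<close>.\<close>

lemma escaping_start:
  obtains S a where "finite S" "S \<subseteq> V" "a \<in> escaping S" "out a \<in> S"
    "\<And>v w. v \<in> S \<Longrightarrow> w \<in> N v \<Longrightarrow> w \<noteq> out v \<Longrightarrow> w \<in> S"
    "\<And>n. saws N S a n \<le> saws N {} (out a) (Suc n)"
proof -
  obtain v where v: "v \<in> V" using inf by fastforce
  obtain b c where V: "b \<in> V" "c \<in> V"
    and N: "N v = {out v, b, c}" "N b = {out b, v, c}" "N c = {out c, v, b}"
    using triangleE[OF v] by metis
  define T where "T = {v, b, c}"
  have T: "finite T" "T \<subseteq> V" using v V by (auto simp: T_def)
  have closed: "w \<in> T" if "t \<in> T" "w \<in> N t" "w \<noteq> out t" for t w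
    using that N by (auto simp: T_def)
  have "\<exists>t\<in>T. out t \<in> escaping T"
  proof (rule ccontr)
    assume no: "\<not> ?thesis"
    have "T \<union> (\<Union>t\<in>T. reach T (out t)) = V"
    proof (rule closed_eq)
      show "T \<union> (\<Union>t\<in>T. reach T (out t)) \<subseteq> V" using T out_in reach_in by blast
      fix x assume x: "x \<in> T \<union> (\<Union>t\<in>T. reach T (out t))"
      show "N x \<subseteq> T \<union> (\<Union>t\<in>T. reach T (out t))"
      proof
        fix y assume y: "y \<in> N x"
        consider "y \<in> T" | "x \<in> T" "y = out x" | "x \<notin> T" "y \<notin> T" using closed y by blast
        then show "y \<in> T \<union> (\<Union>t\<in>T. reach T (out t))"
          using x y by cases (auto intro: reach.intros)
      qed
    qed (simp add: T_def)
    moreover have "finite (T \<union> (\<Union>t\<in>T. reach T (out t)))"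
      using no T out_in by (auto simp: escaping_def)
    ultimately show False using inf by simp
  qed
  then obtain t where t: "t \<in> T" "out t \<in> escaping T" by blast
  have tV: "t \<in> V" using t T by blast
  have "saws N T (out t) n \<le> saws N {} t (Suc n)" for n
  proof -
    have "saws N T (out t) n \<le> saws N {t} (out t) n" using t tV out_in by (intro saws_mono) auto
    also have "\<dots> \<le> saws N {} t (Suc n)"
      using tV out_nbs[OF tV] nbs_irrefl[of t] by (intro saws_Suc_ge1) auto
    finally show ?thesis .
  qed
  then show thesis using that[OF T t(2)] t tV out_out closed by auto
qed

text \<open>Counts below \<open>t ^ n\<close> would make the series weighted by \<open>r ^ n\<close>
  converge by comparison with a geometric one, but \<open>weighted_saws_ge\<close> makes its partial
  sums unbounded.\<close>

lemma not_eventually_saws_le: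
  fixes r t :: real
  assumes r: "0 < r" "r ^ 2 + r ^ 3 = 1 / sqrt 2" and v: "v \<in> V" and t: "0 \<le> t" "t * r < 1"
  shows "\<not> eventually (\<lambda>n. saws N {} v n \<le> t ^ n) sequentially"
proof
  assume ev: "eventually (\<lambda>n. saws N {} v n \<le> t ^ n) sequentially"
  obtain S a where S: "finite S" "S \<subseteq> V" "a \<in> escaping S" "out a \<in> S"
    "\<And>v w. v \<in> S \<Longrightarrow> w \<in> N v \<Longrightarrow> w \<noteq> out v \<Longrightarrow> w \<in> S"
    and le: "\<And>n. saws N S a n \<le> saws N {} (out a) (Suc n)"
    by (rule escaping_start) blast
  define g where "g n = real (saws N S a n) * r ^ n" for n
  have oV: "out a \<in> V" using S by blast
  have g_nonneg: "0 \<le> g n" for n using r by (simp add: g_def)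
  have "summable (\<lambda>n. t * (t * r) ^ n)" using t r by (intro summable_mult summable_geometric) auto
  moreover have "eventually (\<lambda>n. norm (g n) \<le> t * (t * r) ^ n) sequentially"
    using eventually_sequentially_Suc[THEN iffD2, OF ev]
  proof eventually_elim
    case (elim n)
    have "real (saws N S a n) \<le> saws N {} v (Suc n)"
      using le[of n] saws_base_indep[OF oV v] by (simp del: saws.simps)
    then have "real (saws N S a n) \<le> t ^ Suc n" using elim by linarith
    then have "g n \<le> t ^ Suc n * r ^ n" unfolding g_def using r by (intro mult_right_mono) auto
    then show ?case using g_nonneg by (simp add: power_mult_distrib)
  qed
  ultimately have "summable g" by (rule summable_comparison_test_ev[rotated])
  then have bound: "sum g {..n} \<le> suminf g" for n
    using g_nonneg by (intro sum_le_suminf) auto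
  define c where "c = (1 / sqrt 2) ^ potential S"
  have "0 < c" by (simp add: c_def)
  obtain k :: nat where "suminf g / c < k" using reals_Archimedean2 by blast
  then have "suminf g < real (Suc k) * c" using \<open>0 < c\<close> by (simp add: field_simps)
  also have "\<dots> \<le> sum g {..3 * k}"
    unfolding g_def c_def using weighted_saws_ge[OF r S] by simp
  finally show False using bound[of "3 * k"] by simp
qed

text \<open>If one count were 0, submultiplicativity would make all later ones 0, which the
  divergence with \<open>t = 0\<close> excludes.\<close>

lemma saws_pos:
  fixes r :: real
  assumes r: "0 < r" "r ^ 2 + r ^ 3 = 1 / sqrt 2" and v: "v \<in> V"
  shows "1 \<le> saws N {} v n"
proof (rule ccontr)
  assume "\<not> ?thesis"
  then have "saws N {} v n = 0" by simp
  then have "saws N {} v (n + j) = 0" for j using saws_add_le[OF v v, of "{}" n j] by simp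
  then have "eventually (\<lambda>m. saws N {} v m \<le> (0::real) ^ m) sequentially"
    unfolding eventually_sequentially by (metis le_add_diff_inverse of_nat_0 zero_le_power order_refl)
  then show False using not_eventually_saws_le[OF r v, of 0] by simp
qed

text \<open>For the lower bound take \<open>r = 1 / x1\<close>: a limit below \<open>x1\<close>
  would put the counts below \<open>t ^ n\<close> for some \<open>t < x1\<close>. For the upper
  bound the constant 45 disappears under the root.\<close>

lemma root_saws_limit:
  fixes x1 x2 :: real
  assumes x1: "1 < x1" "1 / x1 ^ 2 + 1 / x1 ^ 3 = 1 / sqrt 2"
    and x2: "1 < x2" "1 / x2 ^ 2 + 1 / x2 ^ 3 = 1 / 2"
  obtains \<mu> where "\<And>v. v \<in> V \<Longrightarrow> (\<lambda>n. root n (real (saws N {} v n))) \<longlonglongrightarrow> \<mu>" "x1 \<le> \<mu>" "\<mu> \<le> x2"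
proof -
  obtain v where v: "v \<in> V" using inf by fastforce
  have r: "0 < 1 / x1" "(1 / x1) ^ 2 + (1 / x1) ^ 3 = 1 / sqrt 2"
    using x1 by (auto simp: power_divide)
  let ?a = "\<lambda>n. root n (real (saws N {} v n))"
  have pos: "1 \<le> saws N {} v n" for n using saws_pos[OF r v] .
  obtain \<mu> where \<mu>: "?a \<longlonglongrightarrow> \<mu>"
    using saws_root_convergent[OF v pos] by (auto simp: convergent_def)
  have "\<mu> \<ge> 0" using \<mu> by (rule LIMSEQ_le_const) (simp add: real_root_ge_zero)
  have "x1 \<le> \<mu>"
  proof (rule ccontr)
    assume "\<not> ?thesis"
    then obtain t where t: "\<mu> < t" "t < x1" using dense[of \<mu> x1] by auto
    have "eventually (\<lambda>n. ?a n < t) sequentially" using \<mu> t(1) by (rule order_tendstoD)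
    then have "eventually (\<lambda>n. saws N {} v n \<le> t ^ n) sequentially"
      using eventually_gt_at_top[of 0]
    proof eventually_elim
      case (elim n)
      have "real (saws N {} v n) = ?a n ^ n" using elim by simp
      also have "\<dots> \<le> t ^ n" using elim by (intro power_mono) auto
      finally show ?case .
    qed
    then show False
      using not_eventually_saws_le[OF r v, of t] t \<open>\<mu> \<ge> 0\<close> x1(1) by (simp add: field_simps)
  qed
  moreover have "\<mu> \<le> x2"
  proof (rule LIMSEQ_le[OF \<mu>])
    show "(\<lambda>n. root n 45 * x2) \<longlonglongrightarrow> x2"
      using tendsto_mult[OF LIMSEQ_root_const[of 45] tendsto_const[of x2]] by simp
    have x2': "x2 ^ 3 = 2 * x2 + 2"
      using x2 by (simp add: field_simps power2_eq_square power3_eq_cube)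
    have "?a n \<le> root n 45 * x2" if "n \<ge> 1" for n
    proof -
      have "?a n \<le> root n (45 * x2 ^ n)"
        using saws_le[OF x2(1) x2' v, of n] that by simp
      also have "\<dots> = root n 45 * x2"
        using that x2(1) by (simp add: real_root_mult real_root_power_cancel)
      finally show ?thesis .
    qed
    then show "\<exists>n0. \<forall>n\<ge>n0. ?a n \<le> root n 45 * x2" by blast
  qed
  moreover have "(\<lambda>n. root n (real (saws N {} w n))) \<longlonglongrightarrow> \<mu>" if "w \<in> V" for w
    using \<mu> saws_base_indep[OF v that] by simp
  ultimately show thesis using that by blast
qed

end

section \<open>From graphs of girth 3 to neighbourhood functions\<close>

lemma transitive_cubic_triangleE:
  assumes "transitive_cubic V N" "u \<in> V" "v \<in> N u" "w \<in> N u" "w \<in> N v"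
  obtains out where "triangle_cubic V N out"
proof -
  interpret transitive_cubic V N by fact
  have "\<forall>x\<in>V. \<exists>x' y z. N x = {x', y, z} \<and> distinct [x', y, z] \<and> z \<in> N y \<and> y \<notin> N x' \<and> z \<notin> N x'"
    using triangle_structure[OF assms(2-)] by blast
  then obtain out where "\<forall>x\<in>V. \<exists>y z. N x = {out x, y, z} \<and> distinct [out x, y, z] \<and>
      z \<in> N y \<and> y \<notin> N (out x) \<and> z \<notin> N (out x)"
    by (rule bchoice[THEN exE])
  then have "triangle_cubic V N out" by unfold_locales blast
  then show thesis by (rule that)
qed

text \<open>The girth is an infimum of integers; without a cycle of length 3 it would be at least 4,
  possibly infinite.\<close>

lemma girth_3_triangle:
  assumes "girth G = 3"
  obtains u v w where "(u, v) \<in> parcs G" "(v, w) \<in> parcs G" "(w, u) \<in> parcs G"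
proof -
  have "\<exists>p. pre_digraph.cycle (with_proj G) p \<and> length p = 3"
  proof (rule ccontr)
    assume no: "\<not> ?thesis"
    have "enat 4 \<le> girth G" unfolding girth_def
    proof (rule INF_greatest)
      fix p assume "p \<in> {p. pre_digraph.cycle (with_proj G) p \<and> 3 \<le> length p}"
      then show "enat 4 \<le> enat (length p)" using no by (cases "length p = 3") auto
    qed
    then show False using assms by (simp flip: numeral_eq_enat)
  qed
  then obtain p where p: "pre_digraph.cycle (with_proj G) p" "length p = 3" by blast
  then obtain e1 e2 e3 where "p = [e1, e2, e3]" by (auto simp: numeral_3_eq_3 length_Suc_conv)
  with p(1) show thesis
    using that[of "fst e1" "fst e2" "fst e3"]
    by (cases e1; cases e2; cases e3)
      (auto simp: pre_digraph.cycle_def pre_digraph.awalk_def cas_with_proj_eq)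
qed

lemma triangle_cubic_neighboursE:
  assumes "infinite_transitive_cubic_graph G" "girth G = 3"
  obtains out where "triangle_cubic (pverts G) (neighbours G) out"
proof -
  interpret transitive_cubic "pverts G" "neighbours G"
    using assms(1) by (rule transitive_cubic_neighbours)
  have "pair_bidirected_digraph G" using assms(1) by (simp add: infinite_transitive_cubic_graph_def)
  then interpret pair_bidirected_digraph G .
  obtain u v w where arcs: "(u, v) \<in> parcs G" "(v, w) \<in> parcs G" "(w, u) \<in> parcs G"
    using girth_3_triangle[OF assms(2)] .
  then have "u \<in> pverts G" "w \<in> pverts G" by (auto dest: in_arcsD1)
  then show thesis
    using arcs nbs_sym[of w u]
    by (intro transitive_cubic_triangleE[OF transitive_cubic_axioms, of u v w, OF _ _ _ _ that])
      (auto simp: neighbours_def)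
qed

lemma connective_constant_eqI:
  assumes G: "infinite_transitive_cubic_graph G"
    and lim: "\<And>v. v \<in> pverts G \<Longrightarrow> (\<lambda>n. root n (real (saws (neighbours G) {} v n))) \<longlonglongrightarrow> \<mu>"
  shows "connective_constant G = \<mu>"
proof -
  interpret transitive_cubic "pverts G" "neighbours G"
    using G by (rule transitive_cubic_neighbours)
  have "pair_bidirected_digraph G" using G by (simp add: infinite_transitive_cubic_graph_def)
  then interpret pair_bidirected_digraph G .
  have eq: "saw_count G n v = saws (neighbours G) {} v n" if "v \<in> pverts G" for v n
    using saw_count_eq_saws[OF pair_wf_digraph_axioms finite_nbs that] .
  obtain v where v: "v \<in> pverts G" using inf by fastforce
  show ?thesis unfolding connective_constant_def
  proof (rule the_equality)
    show "\<forall>v\<in>pverts G. (\<lambda>n. root n (real (saw_count G n v))) \<longlonglongrightarrow> \<mu>"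
      using lim eq by simp
    show "\<nu> = \<mu>" if "\<forall>v\<in>pverts G. (\<lambda>n. root n (real (saw_count G n v))) \<longlonglongrightarrow> \<nu>" for \<nu>
      using that v lim[OF v] eq[OF v] by (auto intro: LIMSEQ_unique)
  qed
qed

section \<open>The tree of triangles\<close>

text \<open>
  The Cayley graph of the free product of cyclic groups of orders 3 and 2, with vertices numbered
  so that \<open>3 * m\<close>, \<open>3 * m + 1\<close>, \<open>3 * m + 2\<close> form a triangle and each triangle other than the
  first one is entered from the first one at its least element: \<open>flip\<close> exchanges \<open>0\<close> with \<open>3\<close>,
  \<open>3 * k + 1\<close> with \<open>6 * k + 6\<close>, and \<open>3 * k + 2\<close> with \<open>6 * k + 9\<close>.
\<close>
definition rot :: "nat \<Rightarrow> nat" where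
  "rot x = (if x mod 3 = 2 then x - 2 else x + 1)"

definition flip :: "nat \<Rightarrow> nat" where
  "flip x =
    (if x mod 3 = 1 then 2 * x + 4 else if x mod 3 = 2 then 2 * x + 5
     else if x = 0 then 3 else if x = 3 then 0 else if even x then x div 2 - 2 else (x - 5) div 2)"

definition tri_tree :: "nat pair_pre_digraph" where
  "tri_tree = \<lparr>pverts = UNIV, parcs = {(x, y). y = rot x \<or> y = rot (rot x) \<or> y = flip x}\<rparr>"

lemma nat_mod_3_cases:
  fixes x :: nat
  obtains (0) k where "x = 3 * k" | (1) k where "x = 3 * k + 1" | (2) k where "x = 3 * k + 2"
proof -
  have "x mod 3 < 3" by simp
  then consider "x mod 3 = 0" | "x mod 3 = 1" | "x mod 3 = 2" by linarith
  then show thesis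
    using that[of "x div 3"] mult_div_mod_eq[of 3 x] by cases simp_all
qed

lemma rot_simps: "rot (3 * k) = 3 * k + 1" "rot (3 * k + 1) = 3 * k + 2" "rot (3 * k + 2) = 3 * k"
proof -
  have "(3 * k + 1) mod 3 = 1" "(3 * k + 2) mod 3 = 2" by presburger+
  then show "rot (3 * k) = 3 * k + 1" "rot (3 * k + 1) = 3 * k + 2" "rot (3 * k + 2) = 3 * k"
    by (simp_all add: rot_def)
qed

lemma rot_rot_rot: "rot (rot (rot x)) = x"
  by (cases x rule: nat_mod_3_cases) (simp_all only: rot_simps)

lemma rot_div_mod: "rot x div 3 = x div 3" "rot x \<noteq> x"
  by (cases x rule: nat_mod_3_cases; simp only: rot_simps; presburger)+

text \<open>One case for each formula of \<open>flip\<close>: the first pair 0 and 3, the two exits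
  of a triangle, and the entries of the triangles behind them.\<close>

lemma nat_mod_6_cases:
  fixes x :: nat
  obtains "x = 0" | "x = 3" | k where "x = 3 * k + 1" | k where "x = 3 * k + 2"
    | k where "x = 6 * k + 6" | k where "x = 6 * k + 9"
proof (cases x rule: nat_mod_3_cases)
  case (0 k)
  show thesis
  proof (cases "even k")
    case True
    then obtain j where "k = 2 * j" by (rule evenE)
    then show thesis using 0 that(1) that(5)[of "j - 1"] by (cases j) simp_all
  next
    case False
    then obtain j where "k = 2 * j + 1" by (rule oddE)
    then show thesis using 0 that(2) that(6)[of "j - 1"] by (cases j) simp_all
  qed
qed (rule that(3,4), assumption)+

lemma flip_simps:
  "flip 0 = 3" "flip 3 = 0" "flip (3 * k + 1) = 6 * k + 6" "flip (3 * k + 2) = 6 * k + 9"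
  "flip (6 * k + 6) = 3 * k + 1" "flip (6 * k + 9) = 3 * k + 2"
proof -
  have "(6 * k + 6) mod 3 = 0" "(6 * k + 9) mod 3 = 0" "odd (6 * k + 9)"
    "Suc (3 * k) mod 3 = 1" "Suc (Suc (3 * k)) mod 3 = 2" by presburger+
  then show "flip 0 = 3" "flip 3 = 0" "flip (3 * k + 1) = 6 * k + 6" "flip (3 * k + 2) = 6 * k + 9"
    "flip (6 * k + 6) = 3 * k + 1" "flip (6 * k + 9) = 3 * k + 2"
    by (auto simp: flip_def)
qed

lemma flip_flip: "flip (flip x) = x"
  by (cases x rule: nat_mod_6_cases) (simp_all only: flip_simps)

lemma flip_div: "flip x div 3 \<noteq> x div 3"
  by (cases x rule: nat_mod_6_cases; simp only: flip_simps; presburger)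

text \<open>Crossing the outer edge at the entry of a triangle leads back towards the first one.
  This is the descent behind the induction rule and the termination of
  \<open>tree_aut\<close>.\<close>

lemma flip_less: "x mod 3 = 0 \<Longrightarrow> x \<noteq> 0 \<Longrightarrow> flip x < x"
  by (cases x rule: nat_mod_6_cases; simp only: flip_simps; presburger)

lemma flip_mod: "x mod 3 \<noteq> 0 \<Longrightarrow> flip x mod 3 = 0 \<and> flip x \<noteq> 0"
  by (cases x rule: nat_mod_6_cases; simp only: flip_simps; presburger)

lemma tri_tree_simps [simp]:
  "pverts tri_tree = UNIV"
  "(x, y) \<in> parcs tri_tree \<longleftrightarrow> y = rot x \<or> y = rot (rot x) \<or> y = flip x"
  "neighbours tri_tree x = {flip x, rot x, rot (rot x)}"
  by (auto simp: tri_tree_def neighbours_def)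

lemma rot_flip_induct [case_names zero rot flip]:
  assumes "P 0" "\<And>x. P x \<Longrightarrow> P (rot x)" "\<And>x. P x \<Longrightarrow> P (flip x)"
  shows "P x"
proof (induction x rule: less_induct)
  case (less x)
  show ?case
  proof (cases x rule: nat_mod_3_cases)
    case (0 k)
    show ?thesis
    proof (cases "x = 0")
      case False
      then have "P (flip x)" using 0 by (intro less.IH flip_less) simp_all
      then have "P (flip (flip x))" by (rule assms(3))
      then show ?thesis by (simp only: flip_flip)
    qed (simp only: assms(1))
  next
    case (1 k)
    then have "P (rot (3 * k))" by (intro assms(2) less.IH) simp
    then show ?thesis by (simp only: 1 rot_simps)
  next
    case (2 k)
    then have "P (rot (3 * k + 1))" by (intro assms(2) less.IH) simp
    then show ?thesis by (simp only: 2 rot_simps)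
  qed
qed

text \<open>Both generators have finite order, so a path from 0 to \<open>c\<close> can be run
  backwards using the generators alone.\<close>

lemma rot_flip_to_0:
  assumes "P c" and rot: "\<And>x. P x \<Longrightarrow> P (rot x)" and flip: "\<And>x. P x \<Longrightarrow> P (flip x)"
  shows "P 0"
  using assms(1)
proof (induction c rule: rot_flip_induct)
  case (rot x)
  then show ?case using assms(2)[OF assms(2)[OF rot.prems]] by (simp add: rot_rot_rot)
next
  case (flip x)
  then show ?case using assms(3)[OF flip.prems] by (simp add: flip_flip)
qed

text \<open>The translation of the Cayley graph that sends 0 to \<open>c\<close>, computed along the
  path back to 0 so that it commutes with \<open>rot\<close> and \<open>flip\<close>.\<close>

function tree_aut :: "nat \<Rightarrow> nat \<Rightarrow> nat" where
  "tree_aut c x =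
    (if x = 0 then c else if x mod 3 = 0 then flip (tree_aut c (flip x)) else rot (tree_aut c (x - 1)))"
  by pat_completeness auto
termination
  by (relation "Wellfounded.measure snd") (auto simp: flip_less)

declare tree_aut.simps [simp del]

lemma tree_aut_0: "tree_aut c 0 = c"
  by (simp add: tree_aut.simps)

lemma tree_aut_rot: "tree_aut c (rot x) = rot (tree_aut c x)"
proof -
  have "tree_aut c (3 * k + 1) = rot (tree_aut c (3 * k))"
    "tree_aut c (3 * k + 2) = rot (tree_aut c (3 * k + 1))" for k
  proof -
    have "(3 * k + 1) mod 3 = 1" "(3 * k + 2) mod 3 = 2" "3 * k + 2 - 1 = 3 * k + 1" by presburger+
    then show "tree_aut c (3 * k + 1) = rot (tree_aut c (3 * k))"
      "tree_aut c (3 * k + 2) = rot (tree_aut c (3 * k + 1))"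
      using tree_aut.simps[of c "3 * k + 1"] tree_aut.simps[of c "3 * k + 2"] by simp_all
  qed
  then show ?thesis
    by (cases x rule: nat_mod_3_cases) (simp_all only: rot_simps rot_rot_rot)
qed

lemma tree_aut_flip: "tree_aut c (flip x) = flip (tree_aut c x)"
proof (cases "x mod 3 = 0 \<and> x \<noteq> 0")
  case True
  then have "tree_aut c x = flip (tree_aut c (flip x))" by (subst tree_aut.simps) simp
  then show ?thesis by (simp add: flip_flip)
next
  case False
  then have "flip x mod 3 = 0 \<and> flip x \<noteq> 0" using flip_mod[of x] flip_simps(1) by auto
  then show ?thesis by (subst tree_aut.simps) (simp add: flip_flip)
qed

text \<open>The range is closed under the generators and hence everything. With \<open>d\<close> a
  preimage of 0, the composition fixes 0 and commutes with the generators, so it is the identity;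
  surjectivity of \<open>tree_aut d\<close> gives the other side.\<close>

lemma tree_aut_inverse:
  obtains d where "\<And>x. tree_aut c (tree_aut d x) = x" "\<And>x. tree_aut d (tree_aut c x) = x"
proof -
  have step: "rot x \<in> range (tree_aut c)" "flip x \<in> range (tree_aut c)" if "x \<in> range (tree_aut c)" for x c
    using that by (auto simp flip: tree_aut_rot tree_aut_flip)
  have surj: "x \<in> range (tree_aut c)" for x c
  proof (induction x rule: rot_flip_induct)
    case zero
    have "c \<in> range (tree_aut c)" using tree_aut_0[of c, symmetric] by (rule range_eqI)
    then show ?case using step by (rule rot_flip_to_0)
  qed (use step in auto)
  obtain d where d: "tree_aut c d = 0" using surj[of 0 c] by (metis rangeE)
  have cd: "tree_aut c (tree_aut d x) = x" for x
    by (induction x rule: rot_flip_induct) (auto simp: tree_aut_0 tree_aut_rot tree_aut_flip d)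
  moreover have "tree_aut d (tree_aut c x) = x" for x
  proof -
    obtain e where "x = tree_aut d e" using surj[of x d] by (rule rangeE)
    then show ?thesis by (simp add: cd)
  qed
  ultimately show thesis using that by blast
qed

lemma vertex_transitive_tri_tree: "vertex_transitive tri_tree"
  unfolding vertex_transitive_def
proof (intro ballI)
  fix u v
  obtain u' where u': "\<And>x. tree_aut u (tree_aut u' x) = x" "\<And>x. tree_aut u' (tree_aut u x) = x"
    using tree_aut_inverse[of u] by metis
  obtain v' where v': "\<And>x. tree_aut v (tree_aut v' x) = x" "\<And>x. tree_aut v' (tree_aut v x) = x"
    using tree_aut_inverse[of v] by metis
  \<comment> \<open>Send \<open>u\<close> to 0 by the inverse translation, then 0 to
    \<open>v\<close>.\<close>
  define f where "f = tree_aut v \<circ> tree_aut u'"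
  have f: "f (rot x) = rot (f x)" "f (flip x) = flip (f x)" for x
    by (simp_all add: f_def tree_aut_rot tree_aut_flip)
  have bij: "bij f"
    by (rule o_bij[of "tree_aut u \<circ> tree_aut v'"]) (auto simp: f_def fun_eq_iff u' v')
  have "automorphism tri_tree f"
    unfolding automorphism_def using bij by (auto simp: f[symmetric] inj_eq[OF bij_is_inj])
  moreover have "f u = v"
    using u'(2)[of 0] by (simp add: f_def tree_aut_0)
  ultimately show "\<exists>f. automorphism tri_tree f \<and> f u = v" by blast
qed

lemma flip_neq: "flip x \<noteq> x" "flip x \<noteq> rot x" "flip x \<noteq> rot (rot x)"
  using flip_div[of x] rot_div_mod(1)[of x] rot_div_mod(1)[of "rot x"] by metis+

lemma rot_rot_neq: "rot (rot x) \<noteq> x"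
  by (metis rot_div_mod(2) rot_rot_rot)

lemma infinite_transitive_cubic_graph_tri_tree: "infinite_transitive_cubic_graph tri_tree"
  unfolding infinite_transitive_cubic_graph_def
proof (intro conjI)
  show "pair_bidirected_digraph tri_tree"
  proof
    show "symmetric (with_proj tri_tree)"
      by (auto simp: symmetric_def sym_def rot_rot_rot flip_flip)
    show "fst e \<noteq> snd e" if "e \<in> parcs tri_tree" for e
      using that flip_neq(1)[of "fst e"] rot_div_mod(2)[of "fst e"] rot_rot_neq[of "fst e"]
      by (cases e) auto
  qed auto
  show "infinite (pverts tri_tree)" by simp
  show "vertex_transitive tri_tree" by (rule vertex_transitive_tri_tree)
  show "cubic tri_tree"
    unfolding cubic_def
  proof
    fix v
    have "out_arcs (with_proj tri_tree) v = Pair v ` {flip v, rot v, rot (rot v)}"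
      by (auto simp: out_arcs_def)
    then show "out_degree (with_proj tri_tree) v = 3"
      using flip_neq[of v] rot_div_mod(2)[of "rot v"] by (auto simp: out_degree_def)
  qed
  have sub: "parcs tri_tree \<subseteq> (parcs tri_tree)\<^sup>s" by (auto simp: symcl_def)
  have to: "(0, x) \<in> rtrancl_on UNIV ((parcs tri_tree)\<^sup>s)" for x
  proof (induction x rule: rot_flip_induct)
    case (rot x)
    then show ?case using sub by (auto intro!: rtrancl_on_into_rtrancl_on[OF rot])
  next
    case (flip x)
    then show ?case using sub by (auto intro!: rtrancl_on_into_rtrancl_on[OF flip])
  qed simp
  have "sym ((parcs tri_tree)\<^sup>s)" by (auto simp: symcl_def sym_def)
  then have "sym (rtrancl_on UNIV ((parcs tri_tree)\<^sup>s))" by (rule rtrancl_on_sym)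
  then show "Digraph_Component.connected (with_proj tri_tree)"
    unfolding connected_conv using to by (auto dest: symD intro: rtrancl_on_trans)
qed

lemma girth_tri_tree: "girth tri_tree = 3"
proof (rule antisym)
  have "pre_digraph.cycle (with_proj tri_tree) [(0, 1), (1, 2), (2, 0)]"
    by (auto simp: pre_digraph.cycle_def pre_digraph.awalk_def cas_with_proj_eq
        awalk_verts_with_proj_eq rot_def)
  then have "girth tri_tree \<le> enat (length [(0, 1), (1, 2), (2, 0 :: nat) :: nat \<times> nat])"
    unfolding girth_def by (intro INF_lower) auto
  then show "girth tri_tree \<le> 3" by (simp add: numeral_eq_enat numeral_3_eq_3)
  show "3 \<le> girth tri_tree"
    unfolding girth_def by (intro INF_greatest) (auto simp: numeral_eq_enat)
qed

lemma triangle_cubic_tri_tree: "triangle_cubic UNIV (neighbours tri_tree) flip"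
proof -
  interpret transitive_cubic UNIV "neighbours tri_tree"
    using transitive_cubic_neighbours[OF infinite_transitive_cubic_graph_tri_tree] by simp
  show ?thesis
  proof
    fix x
    have "rot x \<notin> neighbours tri_tree (flip x)" "rot (rot x) \<notin> neighbours tri_tree (flip x)"
      using flip_div[of x] rot_div_mod rot_div_mod(2)[of x] rot_rot_neq[of x] by (auto simp: flip_flip) metis+
    then show "\<exists>y z. neighbours tri_tree x = {flip x, y, z} \<and> distinct [flip x, y, z] \<and>
        z \<in> neighbours tri_tree y \<and> y \<notin> neighbours tri_tree (flip x) \<and> z \<notin> neighbours tri_tree (flip x)"
      using flip_neq[of x] rot_div_mod(2)[of "rot x"] by (intro exI[of _ "rot x"] exI[of _ "rot (rot x)"]) auto
  qed
qed

text \<open>Both exits of triangle \<open>m\<close> lead to the entries of triangles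
  \<open>2 * m + 2\<close> and \<open>2 * m + 3\<close>, beyond every visited vertex, so no passage
  is ever blocked and the recursion of the upper bound holds reversed. The factor
  \<open>1 / 8\<close> covers \<open>n < 3\<close> because \<open>x < 2\<close>.\<close>

lemma saws_tri_tree_ge:
  fixes x :: real
  assumes x: "1 < x" "x < 2" "x ^ 3 = 2 * x + 2" and "S \<subseteq> {..<3 * m}"
  shows "x ^ n / 8 \<le> saws (neighbours tri_tree) S (3 * m) n"
  using assms(4)
proof (induction n arbitrary: S m rule: less_induct)
  case (less n)
  interpret triangle_cubic UNIV "neighbours tri_tree" flip by (rule triangle_cubic_tri_tree)
  let ?s = "saws (neighbours tri_tree)"
  let ?a = "3 * m" and ?b = "3 * m + 1" and ?c = "3 * m + 2"
  let ?S = "S \<union> {?a, ?b, ?c}"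
  have rots: "rot ?a = ?b" "rot ?b = ?c" "rot ?c = ?a" unfolding rot_def by presburger+
  have N: "neighbours tri_tree ?a = {flip ?a, ?b, ?c}" "neighbours tri_tree ?b = {flip ?b, ?a, ?c}"
    "neighbours tri_tree ?c = {flip ?c, ?a, ?b}"
    unfolding tri_tree_simps rots by blast+
  have flips: "flip ?b = 3 * (2 * m + 2)" "flip ?c = 3 * (2 * m + 3)"
    unfolding flip_simps by simp_all
  have S: "?S \<subseteq> {..<3 * (2 * m + 2)}" "?S \<subseteq> {..<3 * (2 * m + 3)}" using less.prems by force+
  have disj: "?a \<notin> S" "?b \<notin> S" "?c \<notin> S" "flip ?b \<notin> S" "flip ?c \<notin> S"
    using less.prems S unfolding flips by force+
  have dist: "distinct [?a, ?b, ?c, flip ?b]" "distinct [?a, ?b, ?c, flip ?c]"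
    unfolding flips by simp_all
  have B: "flip w \<notin> S" if "w \<in> {?b, ?c}" for w using that disj(4,5) by blast
  have sum2: "(\<Sum>w\<in>{?b, ?c}. h w) = h ?b + h ?c" for h :: "nat \<Rightarrow> nat" by simp
  have ge2: "?s S ?a (Suc (Suc k)) \<ge> ?s ?S (flip ?b) k + ?s ?S (flip ?c) k"
    and ge3: "?s S ?a (Suc (Suc (Suc k))) \<ge> (?s ?S (flip ?b) (Suc k) + ?s ?S (flip ?b) k) +
      (?s ?S (flip ?c) (Suc k) + ?s ?S (flip ?c) k)" for k
    using saws_triangle_ge[of ?a S ?b ?c "{?b, ?c}" k, OF UNIV_I disj(1-3) N dist order_refl B]
    by (simp_all only: sum2)
  have power_le: "x ^ n / 8 \<le> 1" if "n < 3"
  proof -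
    have "x ^ n \<le> 2 ^ n" using x by (intro power_mono) auto
    also have "(2::real) ^ n \<le> 2 ^ 3" using that by (intro power_increasing) auto
    finally show ?thesis by simp
  qed
  consider "n = 0" | "n = 1" | "n = 2" | k where "n = Suc (Suc (Suc k))"
    by (metis One_nat_def Suc_1 not0_implies_Suc)
  then show ?case
  proof cases
    case 1
    then show ?thesis by simp
  next
    case 2
    have "?s S ?a (Suc 0) \<ge> ?s (insert ?a S) ?b 0" using N disj by (intro saws_Suc_ge1) auto
    then have "1 \<le> real (?s S ?a n)" using 2 by (simp del: saws.simps(2))
    then show ?thesis using power_le 2 by linarith
  next
    case 3
    then have "1 \<le> real (?s S ?a n)" using ge2[of 0] by (simp add: numeral_2_eq_2 del: saws.simps(2))
    then show ?thesis using power_le 3 by linarith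
  next
    case (4 k)
    have IH: "x ^ j / 8 \<le> ?s ?S (flip ?b) j" "x ^ j / 8 \<le> ?s ?S (flip ?c) j" if "j \<le> Suc k" for j
      unfolding flips using that 4 S by (intro less.IH; simp)+
    have "x ^ n = x ^ k * x ^ 3" by (simp add: 4 numeral_3_eq_3)
    then have "x ^ n / 8 = (x ^ Suc k / 8 + x ^ k / 8) + (x ^ Suc k / 8 + x ^ k / 8)"
      unfolding x(3) by (simp add: algebra_simps)
    also have "\<dots> \<le> (real (?s ?S (flip ?b) (Suc k)) + real (?s ?S (flip ?b) k)) +
        (real (?s ?S (flip ?c) (Suc k)) + real (?s ?S (flip ?c) k))"
      by (intro add_mono IH) simp_all
    also have "\<dots> \<le> real (?s S ?a n)"
      using of_nat_mono[OF ge3[of k], where 'a = real] 4 by (simp del: saws.simps)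
    finally show ?thesis .
  qed
qed

theorem theorem7p1:
  fixes x\<^sub>1 x\<^sub>2 :: real
  assumes "1 < x\<^sub>1" "x\<^sub>1 < 2" "1 / x\<^sub>1^2 + 1 / x\<^sub>1^3 = 1 / sqrt 2"
    and "1 < x\<^sub>2" "x\<^sub>2 < 2" "1 / x\<^sub>2^2 + 1 / x\<^sub>2^3 = 1 / 2"
  shows "(\<forall>G :: 'a pair_pre_digraph. infinite_transitive_cubic_graph G \<and> girth G = 3 \<longrightarrow>
            x\<^sub>1 \<le> connective_constant G \<and> connective_constant G \<le> x\<^sub>2) \<and>
         (\<exists>H :: nat pair_pre_digraph. infinite_transitive_cubic_graph H \<and> girth H = 3 \<and>
            connective_constant H = x\<^sub>2)"
proof (intro conjI allI impI)
  fix G :: "'a pair_pre_digraph"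
  assume G: "infinite_transitive_cubic_graph G \<and> girth G = 3"
  obtain out where "triangle_cubic (pverts G) (neighbours G) out"
    using triangle_cubic_neighboursE G by blast
  then interpret triangle_cubic "pverts G" "neighbours G" out .
  show "x\<^sub>1 \<le> connective_constant G" "connective_constant G \<le> x\<^sub>2"
    using root_saws_limit[OF assms(1,3,4,6)] connective_constant_eqI G by metis+
next
  interpret triangle_cubic UNIV "neighbours tri_tree" flip by (rule triangle_cubic_tri_tree)
  obtain \<mu> where \<mu>: "\<And>v. (\<lambda>n. root n (real (saws (neighbours tri_tree) {} v n))) \<longlonglongrightarrow> \<mu>"
    and le: "\<mu> \<le> x\<^sub>2"
    using root_saws_limit[OF assms(1,3,4,6)] by auto
  have x: "x\<^sub>2 ^ 3 = 2 * x\<^sub>2 + 2"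
    using assms(4,6) by (simp add: field_simps power2_eq_square power3_eq_cube)
  \<comment> \<open>The walks from vertex 0 with nothing forbidden suffice, since the constant
    \<open>1 / 8\<close> disappears under the root.\<close>
  have "x\<^sub>2 \<le> \<mu>"
  proof (rule LIMSEQ_le[OF _ \<mu>[of 0]])
    show "(\<lambda>n. root n (1 / 8) * x\<^sub>2) \<longlonglongrightarrow> x\<^sub>2"
      using tendsto_mult[OF LIMSEQ_root_const[of "1 / 8"] tendsto_const[of x\<^sub>2]] by simp
    have "root n (1 / 8) * x\<^sub>2 \<le> root n (saws (neighbours tri_tree) {} 0 n)" if "n \<ge> 1" for n
    proof -
      have "root n (1 / 8) * x\<^sub>2 = root n (x\<^sub>2 ^ n / 8)"
        using that assms(4) by (simp add: real_root_mult real_root_divide real_root_power_cancel)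
      also have "\<dots> \<le> root n (saws (neighbours tri_tree) {} 0 n)"
        using saws_tri_tree_ge[OF assms(4,5) x, of "{}" 0 n] that by simp
      finally show ?thesis .
    qed
    then show "\<exists>n0. \<forall>n\<ge>n0. root n (1 / 8) * x\<^sub>2 \<le> root n (saws (neighbours tri_tree) {} 0 n)"
      by blast
  qed
  then have "connective_constant tri_tree = x\<^sub>2"
    using connective_constant_eqI[OF infinite_transitive_cubic_graph_tri_tree] \<mu> le by force
  then show "\<exists>H :: nat pair_pre_digraph. infinite_transitive_cubic_graph H \<and> girth H = 3 \<and>
      connective_constant H = x\<^sub>2"
    using infinite_transitive_cubic_graph_tri_tree girth_tri_tree by blast
qed

end
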